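(* There exists a constant $c>0$ such that for every sufficiently large prime $p$ and every integer $r$ with $1 \leq r \leq c \cdot p$ the following holds. (1) If $p=3k+1$ for an integer $k$, then the number of symmetric complete sum-free subsets of $\mathbb{Z}_p$ of size $k-2r$ is $\frac{p-1}{2} \cdot g(3r+1)$. (2) If $p=3k+2$ for an integer $k$, then the number of symmetric complete sum-free subsets of $\mathbb{Z}_p$ of size $k-2r+1$ is $\frac{p-1}{2} \cdot g(3r)$. Here $g(t)$ denotes the number of $t$-special sets.
   Context: $\mathbb{Z}_p$ is the cyclic group of integers modulo $p$. For subsets $A,B$ of an abelian additive group $G$, $A+B=\{x+y \mid x\in A, y\in B\}$ and $-A=\{-x \mid x\in A\}$. A set $S\subseteq G$ is symmetric if $S=-S$, complete if every $z\in G\setminus S$ satisfies $z\in S+S$, and sum-free if $S\cap(S+S)=\emptyset$. For integers $a\le b$, $[a,b]=\{z\in\mathbb{Z} \mid a\le z\le b\}$. For an integer $t\ge 1$, a set of integers $T\subseteq[0,2t-1]$ is called $t$-special if (i) $|T|=t$, (ii) $2t-1\notin T+T+T$, and (iii) $[0,2t-1+\min(T)]\setminus(2t-1-T)\subseteq T+T$, where $2t-1-T=\{2t-1-x \mid x\in T\}$, $\min(T)$ is the smallest integer in $T$, and all additions are over the integers. For $t\ge 1$, $g(t)$ is the number of $t$-special sets. *)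

theory Defs
  imports
    Complex_Main
    "HOL-Algebra.AbelCoset"
    "HOL-Number_Theory.Residues"
    "HOL-Library.Set_Algebras"
begin

text \<open>
  The group \<open>\<int>\<^sub>p\<close> is the additive group of \<^const>\<open>residue_ring\<close> with carrier
  \<open>{0..p - 1}\<close>; the sumset \<open>A + B\<close> in it is \<open>A <+> B\<close> and \<open>-A\<close> is \<open>a_set_inv A\<close>.
  The predicates below are meant for \<open>S \<subseteq> carrier G\<close>.
\<close>

definition symmetric_set :: "('a, 'b) ring_scheme \<Rightarrow> 'a set \<Rightarrow> bool" where
  "symmetric_set G S \<longleftrightarrow> S = a_set_inv\<^bsub>G\<^esub> S"

definition complete_set :: "('a, 'b) ring_scheme \<Rightarrow> 'a set \<Rightarrow> bool" where
  "complete_set G S \<longleftrightarrow> (\<forall>z \<in> carrier G - S. z \<in> S <+>\<^bsub>G\<^esub> S)"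

definition sum_free_set :: "('a, 'b) ring_scheme \<Rightarrow> 'a set \<Rightarrow> bool" where
  "sum_free_set G S \<longleftrightarrow> S \<inter> (S <+>\<^bsub>G\<^esub> S) = {}"

definition symmetric_complete_sum_free_sets :: "('a, 'b) ring_scheme \<Rightarrow> 'a set set" where
  "symmetric_complete_sum_free_sets G =
     {S. S \<subseteq> carrier G \<and> symmetric_set G S \<and> complete_set G S \<and> sum_free_set G S}"

text \<open>
  Here \<open>+\<close> on \<^typ>\<open>int set\<close> is the sumset over the integers. Only \<open>t \<ge> 1\<close> is meaningful:
  then \<open>card T = t\<close> makes \<open>T\<close> nonempty, so that \<open>Min T\<close> is its smallest element.
\<close>

definition special :: "int \<Rightarrow> int set \<Rightarrow> bool" where
  "special t T \<longleftrightarrow>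
     T \<subseteq> {0..2 * t - 1} \<and>
     int (card T) = t \<and>
     2 * t - 1 \<notin> T + T + T \<and>
     {0..2 * t - 1 + Min T} - (\<lambda>x. 2 * t - 1 - x) ` T \<subseteq> T + T"

definition g :: "int \<Rightarrow> nat" where
  "g t = card {T. special t T}"

end

theory Submission
  imports Defs
begin

text \<open>
  Let \<open>S\<close> be a symmetric complete sum-free subset of \<open>\<int>\<^sub>p\<close> whose size \<open>n\<close> is close to \<open>p / 3\<close>. The
  theorem rests on a structure result: some dilate of \<open>S\<close> is contained in the interval \<open>[n, p - n]\<close>, which
  has only slightly more than \<open>n\<close> elements.

  The structure result starts from a Fourier coefficient. Since \<open>S\<close> is symmetric and sum-free, no three
  elements sum to 0, and Parseval's identity yields a coefficient of about \<open>- p / 6\<close> or less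
  (\<open>exists_negative_cosine_sum\<close>); after a dilation it is the one at frequency 1. By a sharpened form of Freiman's
  lemma (\<open>cosine_sum_le\<close>) some half circle then contains more than \<open>(1/4 + \<epsilon>) p\<close> elements of \<open>S\<close>. Let \<open>A\<close>
  be the part of \<open>S\<close> in a fullest half circle, with convex hull of length \<open>L\<close>. Sums of two elements of
  \<open>A\<close> do not wrap around, and as \<open>A\<close> fills more than half of its hull, pigeonhole gives
  \<open>\<bar>A + A\<bar> \<ge> \<bar>A\<bar> + L\<close> (\<open>card_sumset_dense\<close>). These sums avoid \<open>S\<close>, and so do their negatives; counting the room that they leave
  shows first that \<open>A = -A\<close>, next that \<open>A\<close> is centred at \<open>p / 2\<close>, and finally that \<open>A\<close> is all of \<open>S\<close>
  (\<open>dense_window_imp_middle\<close>). The threshold \<open>1/4\<close> is what these counts need with nothing to spare, which is why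
  Freiman's lemma has to be sharpened.

  The dilation factor is unique up to sign, because a nontrivial dilation does not preserve being almost
  an interval (\<open>middle_dilate_unique\<close>). This accounts for the factor \<open>(p - 1) / 2\<close>. Write \<open>p = 3 n + 2 t - 1\<close>.
  A symmetric complete sum-free set of size \<open>n\<close> in \<open>[n, p - n]\<close> contains the whole central block
  \<open>[n + 2 t, 2 n - 1]\<close>, and it is determined by its trace \<open>n + T\<close> on the first \<open>2 t\<close> residues. In terms of \<open>T\<close>,
  having size \<open>n\<close>, being sum-free and being complete are the three conditions for a \<open>t\<close>-special set
  (\<open>left_edge_special\<close>, \<open>lift_special\<close>).
\<close>

section \<open>Sumsets of dense sets of integers\<close>

text \<open>
  A special case of Freiman's \<open>3k - 3\<close> theorem that only needs pigeonhole. Let \<open>L = v - u\<close>. Modulo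
  \<open>L\<close> the set \<open>A\<close> occupies more than half of the residues, so \<open>A + A\<close> meets every residue
  class. The class of \<open>u + a\<close> with \<open>a \<in> A\<close> is even met twice, in \<open>u + a\<close> and in \<open>v + a\<close>.
\<close>

lemma card_sumset_dense:
  fixes A :: "int set"
  assumes fin: "finite A" and u: "u \<in> A" and v: "v \<in> A" and sub: "A \<subseteq> {u..v}"
    and dense: "v - u + 2 < 2 * int (card A)"
  shows "int (card A) + (v - u) \<le> int (card (A + A))"
proof -
  define L where "L = v - u"
  have "u \<noteq> v"
  proof
    assume "u = v"
    with sub have "A \<subseteq> {u}" by auto
    then have "card A \<le> 1" using card_mono[of "{u}" A] by simp
    with dense \<open>u = v\<close> show False by simp
  qed
  then have L: "L > 0" using sub u by (auto simp: L_def)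
  have v_eq: "v = u + L" by (simp add: L_def)
  define W where "W = {2*u..<2*u+L}"
  \<comment> \<open>The window \<open>W\<close> is a full set of residues mod \<open>L\<close>; \<open>B1\<close> and \<open>B2\<close> are the lower and upper halves of \<open>A + A\<close> moved into it.\<close>
  define B1 where "B1 = (A + A) \<inter> W"
  define B2 where "B2 = {r \<in> W. r + L \<in> A + A}"
  let ?A' = "A - {v}"
  have cA': "int (card ?A') = int (card A) - 1"
    using card.remove[OF fin v] by simp
  have A'sub: "?A' \<subseteq> {u..<v}" using sub by auto
  have cover: "W \<subseteq> B1 \<union> B2"
  proof
    fix r assume r: "r \<in> W"
    define f where "f a = u + ((r - a - u) mod L)" for a
    have inj: "inj_on f ?A'"
    proof (rule inj_onI)
      fix a b assume ab: "a \<in> ?A'" "b \<in> ?A'" "f a = f b"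
      then have "(r - a - u) mod L = (r - b - u) mod L" by (simp add: f_def)
      then have "L dvd (r - a - u) - (r - b - u)" by (simp add: mod_eq_dvd_iff)
      then have "L dvd b - a" by (simp add: algebra_simps)
      moreover have "a \<in> {u..<v}" "b \<in> {u..<v}" using ab(1,2) A'sub by blast+
      then have "\<bar>b - a\<bar> < L" by (auto simp: L_def)
      ultimately show "a = b" using dvd_imp_le_int[of "b - a" L] by force
    qed
    have fsub: "f ` ?A' \<subseteq> {u..<v}" using L by (auto simp: f_def v_eq)
    have "?A' \<inter> f ` ?A' \<noteq> {}"
    proof
      assume "?A' \<inter> f ` ?A' = {}"
      then have "card (?A' \<union> f ` ?A') = card ?A' + card ?A'"
        using fin by (subst card_Un_disjoint) (auto simp: card_image[OF inj])
      moreover have "card (?A' \<union> f ` ?A') \<le> card {u..<v}"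
        using A'sub fsub by (intro card_mono) auto
      ultimately have "2 * int (card ?A') \<le> L" using L by (simp add: L_def)
      then show False using cA' dense by (simp add: L_def)
    qed
    then obtain a b where ab: "a \<in> ?A'" "b \<in> ?A'" "a = f b" by auto
    have "L dvd (a + b) - r"
    proof -
      have "a + b - r = - ((r - b - u) - (r - b - u) mod L)" using ab(3) by (simp add: f_def)
      then show ?thesis by (simp add: minus_mod_eq_mult_div)
    qed
    then obtain q where q: "a + b = r + L * q" by (auto simp: dvd_def algebra_simps)
    have "a \<in> {u..<v}" "b \<in> {u..<v}" using ab(1,2) A'sub by blast+
    then have "2*u \<le> a + b" "a + b < 2*u + 2*L" by (auto simp: v_eq)
    moreover have "2*u \<le> r" "r < 2*u + L" using r by (auto simp: W_def)
    ultimately have "L * (-1) < L * q" "L * q < L * 2" using q by linarith+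
    then have "q > -1" "q < 2" using mult_less_cancel_left_pos[OF L] by blast+
    then have "q = 0 \<or> q = 1" by auto
    moreover have "a + b \<in> A + A" using ab by auto
    ultimately show "r \<in> B1 \<union> B2" using q r by (auto simp: B1_def B2_def)
  qed
  have both: "(\<lambda>a. u + a) ` ?A' \<subseteq> B1 \<inter> B2"
  proof
    fix r assume "r \<in> (\<lambda>a. u + a) ` ?A'"
    then obtain a where a: "a \<in> ?A'" "r = u + a" by auto
    have "r + L = v + a" using a v_eq by simp
    moreover have "u + a \<in> A + A" "v + a \<in> A + A" using a u v by auto
    moreover have "a \<in> {u..<v}" using a A'sub by blast
    ultimately show "r \<in> B1 \<inter> B2" using a by (auto simp: B1_def B2_def W_def v_eq ac_simps)
  qed
  have finS: "finite (A + A)" using fin by (rule finite_set_plus) (rule fin)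
  have finB: "finite B1" "finite B2"
  proof -
    have "finite W" "B1 \<subseteq> W" "B2 \<subseteq> W" by (auto simp: B1_def B2_def W_def)
    then show "finite B1" "finite B2" using finite_subset by blast+
  qed
  have "card ((\<lambda>a. u + a) ` ?A') \<le> card (B1 \<inter> B2)"
    using both finB by (intro card_mono) auto
  then have c1: "card ?A' \<le> card (B1 \<inter> B2)" by (simp add: card_image)
  have "card W \<le> card (B1 \<union> B2)" using cover finB by (intro card_mono) auto
  then have c2: "L \<le> int (card (B1 \<union> B2))" using L by (simp add: W_def)
  have c3: "card B1 + card B2 = card (B1 \<union> B2) + card (B1 \<inter> B2)"
    using finB by (rule card_Un_Int)
  have "B1 \<union> (\<lambda>r. r + L) ` B2 \<union> {2 * u + 2 * L} \<subseteq> A + A"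
    using set_plus_intro[OF v v] v_eq by (auto simp: B1_def B2_def algebra_simps)
  then have "card (B1 \<union> (\<lambda>r. r + L) ` B2 \<union> {2 * u + 2 * L}) \<le> card (A + A)"
    using finS by (intro card_mono)
  also have "card (B1 \<union> (\<lambda>r. r + L) ` B2 \<union> {2 * u + 2 * L}) = card B1 + card B2 + 1"
  proof -
    have "B1 \<inter> (\<lambda>r. r + L) ` B2 = {}" "2 * u + 2 * L \<notin> B1 \<union> (\<lambda>r. r + L) ` B2"
      using L by (auto simp: B1_def B2_def W_def)
    then show ?thesis using finB by (simp add: card_Un_disjoint card_image)
  qed
  finally show ?thesis using c1 c2 c3 cA' by (simp add: L_def)
qed

section \<open>Structure from a dense window\<close>

text \<open>
  Subsets of \<open>\<int>\<^sub>p\<close> are represented by their preimages in \<open>\<int>\<close>: a set \<open>X\<close> of integers that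
  is invariant under translation by \<open>p\<close>. Windows \<open>{a..<a+m}\<close> and sumsets are then taken in \<open>\<int>\<close>,
  and \<open>m\<close> is half a period, so that sums of two elements of a window of length \<open>m\<close> do not wrap around.
\<close>

locale sym_sum_free =
  fixes p m :: int and X :: "int set"
  assumes p_eq: "p = 2 * m + 1" and m_pos: "m \<ge> 1"
    and periodic: "x \<in> X \<Longrightarrow> x + j * p \<in> X"
    and sym: "x \<in> X \<Longrightarrow> - x \<in> X"
    and sum_free: "x \<in> X \<Longrightarrow> y \<in> X \<Longrightarrow> x + y \<notin> X"
begin

definition period_card :: int where "period_card = int (card (X \<inter> {0..<p}))"

lemma p_pos: "p > 0" using p_eq m_pos by simp

lemma periodic_iff: "x + j * p \<in> X \<longleftrightarrow> x \<in> X"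
  using periodic[of x j] periodic[of "x + j * p" "- j"] by auto

lemma mod_iff: "x mod p \<in> X \<longleftrightarrow> x \<in> X"
  using periodic_iff[of "x mod p" "x div p"] by (simp add: mod_div_mult_eq)

lemma sym_iff: "- x \<in> X \<longleftrightarrow> x \<in> X"
  using sym[of x] sym[of "- x"] by auto

lemma reflect_iff: "j * p - x \<in> X \<longleftrightarrow> x \<in> X"
  using periodic_iff[of "- x" j] sym_iff[of x] by (simp add: algebra_simps)

lemma reflect: "p - x \<in> X \<longleftrightarrow> x \<in> X"
  using reflect_iff[of 1 x] by simp

lemma zero_notin: "0 \<notin> X" using sum_free[of 0 0] by auto

lemma card_period: "int (card (X \<inter> {a..<a+p})) = period_card"
proof -
  have "bij_betw (\<lambda>x. x mod p) (X \<inter> {a..<a+p}) (X \<inter> {0..<p})"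
  proof (rule bij_betwI[where g = "\<lambda>y. a + (y - a) mod p"])
    show "(\<lambda>x. x mod p) \<in> X \<inter> {a..<a + p} \<rightarrow> X \<inter> {0..<p}"
      using p_pos by (auto simp: mod_iff)
    show "(\<lambda>y. a + (y - a) mod p) \<in> X \<inter> {0..<p} \<rightarrow> X \<inter> {a..<a + p}"
    proof
      fix y assume y: "y \<in> X \<inter> {0..<p}"
      have "a + (y - a) mod p = y + (- ((y - a) div p)) * p"
        using mod_div_mult_eq[of "y - a" p] by (simp add: algebra_simps)
      then have "a + (y - a) mod p \<in> X" using y periodic by (metis IntD1)
      then show "a + (y - a) mod p \<in> X \<inter> {a..<a + p}" using p_pos by auto
    qed
    show "a + (x mod p - a) mod p = x" if "x \<in> X \<inter> {a..<a + p}" for x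
      using that by (simp add: mod_diff_left_eq)
    show "(a + (y - a) mod p) mod p = y" if "y \<in> X \<inter> {0..<p}" for y
      using that by (simp add: mod_add_right_eq)
  qed
  then show ?thesis by (simp add: period_card_def bij_betw_same_card)
qed

lemma card_avoiding:
  assumes "Y \<subseteq> {a..<a+p}" "Y \<inter> X = {}"
  shows "int (card Y) + period_card \<le> p"
proof -
  have fY: "finite Y" using assms(1) finite_subset by blast
  have "card (Y \<union> (X \<inter> {a..<a+p})) \<le> card {a..<a+p}"
    using assms by (intro card_mono) auto
  moreover have "card (Y \<union> (X \<inter> {a..<a+p})) = card Y + card (X \<inter> {a..<a+p})"
    using assms fY by (intro card_Un_disjoint) auto
  ultimately show ?thesis using card_period[of a] p_pos by simp
qed

lemma card_half_period: "2 * int (card (X \<inter> {1..m})) = period_card"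
proof -
  have "bij_betw (\<lambda>x. p - x) (X \<inter> {1..m}) (X \<inter> {m+1..2*m})"
    by (rule bij_betwI[where g = "\<lambda>x. p - x"]) (auto simp: reflect, auto simp: p_eq)
  then have eq: "card (X \<inter> {1..m}) = card (X \<inter> {m+1..2*m})" by (rule bij_betw_same_card)
  have "X \<inter> {0..<p} = (X \<inter> {1..m}) \<union> (X \<inter> {m+1..2*m})"
  proof (intro equalityI subsetI)
    fix x assume "x \<in> X \<inter> {0..<p}"
    moreover from this have "x \<noteq> 0" using zero_notin by auto
    ultimately show "x \<in> (X \<inter> {1..m}) \<union> (X \<inter> {m+1..2*m})" by (auto simp: p_eq)
  qed (auto simp: p_eq)
  then have "card (X \<inter> {0..<p}) = card (X \<inter> {1..m}) + card (X \<inter> {m+1..2*m})"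
    using card_Un_disjoint[of "X \<inter> {1..m}" "X \<inter> {m+1..2*m}"] by fastforce
  then show ?thesis using eq by (simp add: period_card_def)
qed

text \<open>
  A part \<open>A\<close> of \<open>X\<close> that fills a window of length \<open>m\<close> as well as possible, described by its
  convex hull \<open>{u..v}\<close> and not by the window, so that maximality applies to every window around
  the hull.
\<close>

definition densest :: "int set \<Rightarrow> int \<Rightarrow> int \<Rightarrow> bool" where
  "densest A u v \<longleftrightarrow> A = X \<inter> {u..v} \<and> u \<in> A \<and> v \<in> A \<and> v - u < m \<and>
     (\<forall>b. card (X \<inter> {b..<b+m}) \<le> card A)"

lemma densest_reflect:
  assumes "densest A u v" shows "densest (uminus ` A) (- v) (- u)"
proof -
  have "uminus ` A = X \<inter> {- v..- u}"
  proof (intro equalityI subsetI)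
    fix x assume "x \<in> X \<inter> {- v..- u}"
    then have "- x \<in> A" using assms sym_iff[of x] by (auto simp: densest_def)
    then show "x \<in> uminus ` A" by (metis image_eqI minus_minus)
  qed (use assms sym in \<open>auto simp: densest_def\<close>)
  moreover have "card (uminus ` A) = card A" by (simp add: card_image)
  ultimately show ?thesis using assms unfolding densest_def by auto
qed

lemma densest_translate:
  assumes "densest A u v" shows "densest ((\<lambda>x. x + j * p) ` A) (u + j * p) (v + j * p)"
proof -
  have "(\<lambda>x. x + j * p) ` A = X \<inter> {u + j * p..v + j * p}"
  proof (intro equalityI subsetI)
    fix x assume "x \<in> X \<inter> {u + j * p..v + j * p}"
    then have "x - j * p \<in> A" using assms periodic_iff[of "x - j * p" j] by (auto simp: densest_def)
    then show "x \<in> (\<lambda>x. x + j * p) ` A" by force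
  qed (use assms periodic in \<open>auto simp: densest_def\<close>)
  moreover have "card ((\<lambda>x. x + j * p) ` A) = card A" by (simp add: card_image)
  moreover have "u + j * p \<in> (\<lambda>x. x + j * p) ` A" "v + j * p \<in> (\<lambda>x. x + j * p) ` A"
    using assms by (auto simp: densest_def)
  ultimately show ?thesis using assms unfolding densest_def by auto
qed

text \<open>
  The sumset of \<open>A\<close> avoids \<open>X\<close>, which leaves it at most \<open>p - period_card\<close> residues. Since it is
  large as soon as the hull of \<open>A\<close> is long, the hull is short.
\<close>

lemma densest_sumset:
  assumes d: "densest A u v" and big: "p < 4 * int (card A) - 3"
  shows "int (card A) + (v - u) \<le> int (card (A + A))"
    and "(A + A) \<inter> X = {}" and "A + A \<subseteq> {2*u..2*v}"
    and "v - u \<le> p - period_card - int (card A)"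
proof -
  have A: "A = X \<inter> {u..v}" "u \<in> A" "v \<in> A" "v - u < m" "finite A"
    using d by (auto simp: densest_def)
  show 1: "int (card A) + (v - u) \<le> int (card (A + A))"
    by (rule card_sumset_dense) (use A big p_eq in auto)
  show 2: "(A + A) \<inter> X = {}" using A(1) sum_free by (auto elim!: set_plus_elim)
  show 3: "A + A \<subseteq> {2*u..2*v}" using A(1) by (auto elim!: set_plus_elim)
  have "A + A \<subseteq> {2*u..<2*u+p}" using 3 A(4) p_eq by fastforce
  then have "int (card (A + A)) + period_card \<le> p" using card_avoiding 2 by blast
  then show "v - u \<le> p - period_card - int (card A)" using 1 by simp
qed

text \<open>
  Up to a translation by \<open>j * p\<close>, the sumset \<open>A + A\<close> lives in \<open>{\<sigma> - L..\<sigma> + L}\<close>, where \<open>\<sigma>\<close> measures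
  how far \<open>A\<close> is from being centred. Both \<open>A + A\<close> and its mirror image avoid \<open>X\<close>, so half a period
  must accommodate \<open>X\<close> and the positive part of \<open>A + A\<close>. This bounds \<open>\<sigma>\<close> so strongly
  that the hull of \<open>A\<close> and its mirror image fits into one window of length \<open>m\<close>; by maximality \<open>A\<close>
  contains its mirror image, which forces \<open>\<sigma> = 0\<close>. The parameter \<open>e\<close> here and below is
  the admitted defect of the size of \<open>X\<close> from \<open>p / 3\<close>.
\<close>

lemma densest_centre_aux:
  assumes d: "densest A u v" and e: "3 * period_card \<ge> p - e" "e \<ge> 0" "4 * int (card A) \<ge> p + 2 * e + 20"
    and \<sigma>: "0 \<le> u + v + j * p" "u + v + j * p \<le> m"
  shows "u + v + j * p = 0"
proof -
  define \<sigma> L N where "\<sigma> = u + v + j * p" and "L = v - u" and "N = int (card A)"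
  have A: "A = X \<inter> {u..v}" "u \<in> A" "v \<in> A" "v - u < m" "finite A" "u \<le> v"
    using d by (auto simp: densest_def)
  note S = densest_sumset[OF d]
  have S1: "N + L \<le> int (card (A + A))" and S4: "L \<le> p - period_card - N"
    using S(1,4) e p_eq m_pos by (auto simp: N_def L_def)
  have S2: "(A + A) \<inter> X = {}" "A + A \<subseteq> {2*u..2*v}" using S(2,3) e p_eq m_pos by auto
  define Y where "Y = (\<lambda>x. x + j * p) ` (A + A)"
  have YX: "Y \<inter> X = {}" using S2(1) periodic_iff by (auto simp: Y_def)
  have Ysub: "Y \<subseteq> {\<sigma> - L..\<sigma> + L}" using S2(2) by (auto simp: Y_def \<sigma>_def L_def)
  have cY: "card Y = card (A + A)" by (simp add: Y_def card_image)
  have finY: "finite Y" using Ysub finite_subset by blast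
  have half: "2 * int (card (Y \<inter> {1..m})) + period_card \<le> 2 * m"
  proof -
    have "card ((Y \<inter> {1..m}) \<union> (X \<inter> {1..m})) \<le> card {1..m}" by (intro card_mono) auto
    moreover have "card ((Y \<inter> {1..m}) \<union> (X \<inter> {1..m})) = card (Y \<inter> {1..m}) + card (X \<inter> {1..m})"
      using YX by (intro card_Un_disjoint) auto
    ultimately show ?thesis using card_half_period m_pos by simp
  qed
  define A' where "A' = (\<lambda>x. x - j * p) ` uminus ` A"
  have A': "A' \<subseteq> {u - \<sigma>..v - \<sigma>}" "A' \<subseteq> X"
    using A(1) periodic_iff[of "- x" "- j" for x] sym_iff by (auto simp: A'_def \<sigma>_def)
  \<comment> \<open>Otherwise \<open>A\<close> and its mirror image would be disjoint, and \<open>X\<close> would contain more than \<open>p / 2\<close> residues.\<close>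
  have \<sigma>L: "\<sigma> - L \<le> 1"
  proof (rule ccontr)
    assume "\<not> \<sigma> - L \<le> 1"
    then have disj: "A \<inter> A' = {}" using A' A(1) by (fastforce simp: L_def)
    have "card (A \<union> A') = card A + card A" using disj A(5)
      by (subst card_Un_disjoint) (auto simp: A'_def card_image inj_on_def)
    moreover have "card (A \<union> A') \<le> card (X \<inter> {u - \<sigma>..<u - \<sigma> + p})"
      using A' A(1,4) \<sigma> p_eq unfolding \<sigma>_def[symmetric] by (intro card_mono) fastforce+
    ultimately have "2 * N \<le> period_card" using card_period[of "u - \<sigma>"] by (simp add: N_def)
    moreover have "card A \<le> card {u..v}" using A(1) by (intro card_mono) auto
    then have "N \<le> L + 1" using A(6) by (simp add: N_def L_def)
    ultimately show False using S4 e p_eq by (simp add: N_def)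
  qed
  have "Y \<subseteq> {\<sigma> - L..0} \<union> (Y \<inter> {1..m}) \<union> {m+1..\<sigma>+L}" using Ysub by auto
  then have "card Y \<le> card ({\<sigma> - L..0} \<union> (Y \<inter> {1..m}) \<union> {m+1..\<sigma>+L})"
    using finY by (intro card_mono) auto
  also have "\<dots> \<le> card {\<sigma> - L..0} + card (Y \<inter> {1..m}) + card {m+1..\<sigma>+L}"
    by (intro order.trans[OF card_Un_le] add_mono card_Un_le) auto
  finally have cnt: "N + L \<le> (1 - \<sigma> + L) + int (card (Y \<inter> {1..m})) + max 0 (\<sigma> + L - m)"
    using S1 cY \<sigma>L by auto
  have hull: "\<sigma> + L < m"
    using cnt half S4 e \<sigma> p_eq A(4)
    unfolding \<sigma>_def[symmetric] L_def[symmetric] N_def[symmetric]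
    by (auto simp: max_def split: if_splits)
  have "A \<union> A' \<subseteq> X \<inter> {u - \<sigma>..<u - \<sigma> + m}"
    using A' A(1) hull \<sigma> by (auto simp: L_def \<sigma>_def)
  then have "card (A \<union> A') \<le> card (X \<inter> {u - \<sigma>..<u - \<sigma> + m})" by (intro card_mono) auto
  also have "\<dots> \<le> card A" using d by (auto simp: densest_def)
  finally have "A = A \<union> A'" using A(5) by (intro card_seteq) (auto simp: A'_def)
  moreover have "- v - j * p \<in> A'" using A(3) by (auto simp: A'_def)
  ultimately have "- v - j * p \<in> A" by blast
  then have "u \<le> - v - j * p" using A(1) by auto
  then show ?thesis using \<sigma> by simp
qed

lemma densest_centre:
  assumes d: "densest A u v" and e: "3 * period_card \<ge> p - e" "e \<ge> 0" "4 * int (card A) \<ge> p + 2 * e + 20"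
  shows "\<exists>j. u + v = j * p"
proof -
  define j where "j = - ((u + v + m) div p)"
  have "u + v + j * p = (u + v + m) mod p - m"
    using mod_div_mult_eq[of "u + v + m" p] by (simp add: j_def algebra_simps)
  then have b: "- m \<le> u + v + j * p" "u + v + j * p \<le> m"
    using pos_mod_bound[OF p_pos, of "u + v + m"] pos_mod_sign[OF p_pos, of "u + v + m"] p_eq
    by auto
  have "u + v + j * p = 0"
  proof (cases "0 \<le> u + v + j * p")
    case True
    then show ?thesis using densest_centre_aux[OF d e] b by blast
  next
    case False
    have e': "4 * int (card (uminus ` A)) \<ge> p + 2 * e + 20" using e(3) by (simp add: card_image)
    have "0 \<le> - v + - u + (- j) * p" "- v + - u + (- j) * p \<le> m" using b False by simp_all
    then have "- v + - u + (- j) * p = 0"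
      by (rule densest_centre_aux[OF densest_reflect[OF d] e(1,2) e'])
    then show ?thesis by simp
  qed
  then have "u + v = (- j) * p" by simp
  then show ?thesis by blast
qed

text \<open>
  Suppose that \<open>A\<close> is centred at 0. For \<open>y\<close> in \<open>A\<close> and \<open>z = \<bar>y\<bar>\<close> the sets \<open>A\<close> and \<open>z + A\<close> are disjoint
  subsets of the hull enlarged by \<open>z\<close>, so \<open>z\<close> is large. Thus \<open>A\<close> is confined to the two ends of its hull,
  which are too short for it.
\<close>

lemma densest_not_centred_at_0:
  assumes d: "densest A u v" and e: "3 * period_card \<ge> p - e" "e \<ge> 0" "4 * int (card A) \<ge> p + 2 * e + 20"
  shows "u + v \<noteq> 0"
proof
  assume 0: "u + v = 0"
  define L N where "L = v - u" and "N = int (card A)"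
  have A: "A = X \<inter> {u..v}" "u \<in> A" "v \<in> A" "v - u < m" "finite A" "u \<le> v"
    using d by (auto simp: densest_def)
  have S4: "L \<le> p - period_card - N" using densest_sumset(4)[OF d] e p_eq m_pos by (auto simp: N_def L_def)
  define w where "w = 2 * N - L - 2"
  have far: "\<bar>y\<bar> > w" if "y \<in> A" for y
  proof (rule ccontr)
    assume "\<not> \<bar>y\<bar> > w"
    define z where "z = \<bar>y\<bar>"
    have z: "z \<in> X" "z \<le> w" "z \<ge> 0" using that A(1) sym_iff[of y] \<open>\<not> \<bar>y\<bar> > w\<close> by (auto simp: z_def abs_if)
    have "A \<inter> (\<lambda>a. z + a) ` A = {}"
      using A(1) z(1) sum_free by auto
    then have "card (A \<union> (\<lambda>a. z + a) ` A) = card A + card A"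
      using A(5) by (subst card_Un_disjoint) (auto simp: card_image)
    moreover have "card (A \<union> (\<lambda>a. z + a) ` A) \<le> card {u..v + z}"
      using A(1) z by (intro card_mono) auto
    ultimately have "2 * N \<le> L + z + 1" using A(6) z(3) by (simp add: N_def L_def)
    then show False using z(2) by (simp add: w_def)
  qed
  have wpos: "w \<ge> 0" using e A(4) p_eq by (auto simp: w_def N_def L_def)
  have uv: "v = - u" using 0 by simp
  have sub: "A \<subseteq> {u..-w-1} \<union> {w+1..v}"
  proof
    fix x assume x: "x \<in> A"
    show "x \<in> {u..-w-1} \<union> {w+1..v}" using far[OF x] x A(1) by (cases "x \<ge> 0") auto
  qed
  have "card A \<le> card ({u..-w-1} \<union> {w+1..v})" using sub by (intro card_mono) auto
  also have "\<dots> \<le> card {u..-w-1} + card {w+1..v}" by (rule card_Un_le)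
  also have "\<dots> = 2 * nat (v - w)" using uv by simp
  finally have "N \<le> int (2 * nat (v - w))" by (simp only: N_def of_nat_le_iff)
  then have "N \<le> 0 \<or> N \<le> 2 * (v - w)" by (cases "v \<ge> w") simp_all
  moreover have "2 * v = L" "w = 2 * N - L - 2" using uv by (simp_all add: L_def w_def)
  moreover have N: "4 * N \<ge> p + 2 * e + 20" using e(3) by (simp add: N_def)
  ultimately have "N \<le> 0 \<or> 5 * N \<le> 3 * L + 4" by auto
  then show False
  proof
    assume "N \<le> 0"
    then show False using N e(2) p_pos by linarith
  next
    assume "5 * N \<le> 3 * L + 4"
    then have "8 * N \<le> 3 * p - 3 * period_card + 4" using S4 by linarith
    then show False using N e(1,2) by linarith
  qed
qed

text \<open>
  Let \<open>A\<close> be centred at \<open>p / 2\<close> and let \<open>y\<close> be an element of \<open>X\<close> outside its hull, without loss of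
  generality to the left. By maximality \<open>y\<close> is close to 0, and by \<open>A \<inter> (A + y) = {}\<close> it is not too
  close. The sumset \<open>A + A - p\<close> already occupies almost all of the residues outside \<open>X\<close>, all of them
  in \<open>{-L..L}\<close>. Hence only few residues of the complementary interval \<open>C\<close> are outside \<open>X\<close>. But
  \<open>A + y\<close> is outside \<open>X\<close>, so \<open>A\<close> nearly misses \<open>C - y\<close>, and it is too dense in its hull for that.
\<close>

lemma densest_centred_at_half:
  assumes d: "densest A u v" and e: "3 * period_card \<ge> p - e" "e \<ge> 0" "4 * int (card A) \<ge> p + 2 * e + 20"
    and uv: "u + v = p"
  shows "X \<inter> {0..<p} \<subseteq> {u..v}"
proof (rule ccontr)
  assume "\<not> X \<inter> {0..<p} \<subseteq> {u..v}"
  then obtain x where x: "x \<in> X" "0 \<le> x" "x < p" "x < u \<or> x > v" by fastforce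
  define L N where "L = v - u" and "N = int (card A)"
  have A: "A = X \<inter> {u..v}" "u \<in> A" "v \<in> A" "v - u < m" "finite A" "u \<le> v"
    using d by (auto simp: densest_def)
  have v_eq: "v = p - u" and L_eq: "L = p - 2 * u" using uv by (auto simp: L_def)
  note S = densest_sumset[OF d]
  have S1: "N + L \<le> int (card (A + A))" and S4: "L \<le> p - period_card - N"
    using S(1,4) e p_eq m_pos by (auto simp: N_def L_def)
  have S2: "(A + A) \<inter> X = {}" "A + A \<subseteq> {2*u..2*v}" using S(2,3) e p_eq m_pos by auto
  have cardA: "4 * N \<ge> p + 2 * e + 20" using e by (simp add: N_def)
  define y where "y = (if x < u then x else p - x)"
  have y: "y \<in> X" "0 \<le> y" "y < u" using x reflect_iff[of 1 x] v_eq by (auto simp: y_def)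
  have y_le: "2 * y \<le> L + 1"
  proof (rule ccontr)
    assume far: "\<not> 2 * y \<le> L + 1"
    then have "y \<notin> A" using A(1) y by auto
    then have "card (insert y A) = Suc (card A)" using A(5) by simp
    moreover have "insert y A \<subseteq> X \<inter> {v + 1 - m..<v + 1 - m + m}"
      using y A(1,4,6) far p_eq by (auto simp: v_eq L_eq)
    then have "card (insert y A) \<le> card (X \<inter> {v + 1 - m..<v + 1 - m + m})" by (intro card_mono) auto
    ultimately show False using d unfolding densest_def by (metis Suc_n_not_le_n le_trans)
  qed
  have y_ge: "2 * N \<le> L + 1 + y"
  proof -
    have "A \<inter> (\<lambda>a. y + a) ` A = {}" using A(1) y(1) sum_free by auto
    then have "card (A \<union> (\<lambda>a. y + a) ` A) = card A + card A"
      using A(5) by (subst card_Un_disjoint) (auto simp: card_image)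
    moreover have "card (A \<union> (\<lambda>a. y + a) ` A) \<le> card {u..v + y}"
      using A(1) y by (intro card_mono) auto
    ultimately show ?thesis using A(6) y(2) by (simp add: N_def L_def)
  qed
  define C where "C = {L+1..p-L-1}"
  define D where "D = C - X"
  define \<nu> where "\<nu> = p - period_card - N - L"
  have D_card: "int (card D) \<le> \<nu>"
  proof -
    define Y where "Y = (\<lambda>x. x - p) ` (A + A)"
    have Ysub: "Y \<subseteq> {-L..L}" using S2(2) by (auto simp: Y_def L_def uv[symmetric])
    have finY: "finite Y" using Ysub finite_subset by blast
    have "card (Y \<union> D) = card Y + card D" using Ysub finY
      by (intro card_Un_disjoint) (auto simp: D_def C_def)
    moreover have "card Y = card (A + A)" by (simp add: Y_def card_image)
    moreover have "(Y \<union> D) \<inter> X = {}"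
      using S2(1) periodic_iff[of "x - p" 1 for x] by (auto simp: Y_def D_def)
    moreover have "Y \<union> D \<subseteq> {-L..<-L+p}" using Ysub A(4,6) p_eq by (auto simp: D_def C_def L_def)
    ultimately have "int (card Y + card D) + period_card \<le> p" using card_avoiding by metis
    then show ?thesis using S1 \<open>card Y = card (A + A)\<close> by (simp add: \<nu>_def)
  qed
  have miss: "int (card (A \<inter> {L+1-y..p-L-1-y})) \<le> \<nu>"
  proof -
    have "card ((\<lambda>a. a + y) ` (A \<inter> {L+1-y..p-L-1-y})) \<le> card D"
      using sum_free y(1) A(1) by (intro card_mono) (auto simp: D_def C_def)
    then show ?thesis using D_card by (simp add: card_image)
  qed
  show False
  proof (cases "L + 1 - y \<ge> u")
    case True
    \<comment> \<open>All of \<open>C - y\<close> lies in the hull, so that \<open>A\<close> misses nearly \<open>p - 2 * L - 1\<close> places of it.\<close>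
    have "A \<subseteq> (A \<inter> {L+1-y..p-L-1-y}) \<union> {u..L-y} \<union> {p-L-y..v}" using A(1) by auto
    then have "card A \<le> card ((A \<inter> {L+1-y..p-L-1-y}) \<union> {u..L-y} \<union> {p-L-y..v})"
      using A(5) by (intro card_mono) auto
    also have "\<dots> \<le> card (A \<inter> {L+1-y..p-L-1-y}) + card {u..L-y} + card {p-L-y..v}"
      by (intro order.trans[OF card_Un_le] add_mono card_Un_le) auto
    finally have "N \<le> \<nu> + (L - y - u + 1) + max 0 (v - (p - L - y) + 1)"
      using miss True by (auto simp: N_def)
    then show False using S4 e(1,2) cardA y_le y_ge L_eq v_eq A(4) p_eq y
      by (auto simp: \<nu>_def max_def split: if_splits)
  next
    case False
    \<comment> \<open>Now \<open>C - y\<close> covers the left end of the hull and, by symmetry, \<open>C + y\<close> covers the right end, which leaves \<open>A\<close> only the middle.\<close>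
    have refl: "card (A \<inter> {L+1+y..v}) = card (A \<inter> {u..p-L-1-y})"
      by (rule bij_betw_same_card[of "\<lambda>x. p - x"], rule bij_betwI[where g = "\<lambda>x. p - x"])
         (use A(1) reflect_iff[of 1] in \<open>auto simp: v_eq\<close>)
    have "card (A \<inter> {u..p-L-1-y}) \<le> card (A \<inter> {L+1-y..p-L-1-y})"
      using False A(5) by (intro card_mono) auto
    then have c: "int (card (A \<inter> {u..p-L-1-y})) \<le> \<nu>" using miss by simp
    have "A \<subseteq> (A \<inter> {u..p-L-1-y}) \<union> (A \<inter> {L+1+y..v}) \<union> {p-L-y..L+y}" using A(1) by auto
    then have "card A \<le> card ((A \<inter> {u..p-L-1-y}) \<union> (A \<inter> {L+1+y..v}) \<union> {p-L-y..L+y})"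
      using A(5) by (intro card_mono) auto
    also have "\<dots> \<le> card (A \<inter> {u..p-L-1-y}) + card (A \<inter> {L+1+y..v}) + card {p-L-y..L+y}"
      by (intro order.trans[OF card_Un_le] add_mono card_Un_le) auto
    finally have "N \<le> 2 * \<nu> + max 0 (2 * L + 2 * y + 1 - p)"
      using c refl by (auto simp: N_def)
    then show False using S4 e(1,2) cardA y_le y_ge L_eq v_eq A(4) p_eq y
      by (auto simp: \<nu>_def max_def split: if_splits)
  qed
qed

text \<open>
  The densest window is centred at a multiple of \<open>p / 2\<close>; a translation by a multiple of \<open>p\<close> reduces
  to the two centres 0 and \<open>p / 2\<close>. In the surviving case \<open>A\<close> is all of \<open>X\<close> in one period, and
  the bound for the length of its hull reads \<open>period_card \<le> u\<close>.
\<close>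

lemma dense_window_imp_middle:
  assumes e: "3 * period_card \<ge> p - e" "e \<ge> 0"
    and w: "4 * int (card (X \<inter> {a..<a+m})) \<ge> p + 2 * e + 20"
  shows "X \<inter> {0..<p} \<subseteq> {period_card..p - period_card}"
proof -
  define f where "f b = card (X \<inter> {b..<b+m})" for b
  have "f b \<le> nat m" for b
    using card_mono[of "{b..<b+m}" "X \<inter> {b..<b+m}"] by (simp add: f_def)
  then obtain b where b: "\<And>c. f c \<le> f b"
    using ex_has_greatest_nat[of "\<lambda>_. True" 0 f "Suc (nat m)"] by (auto simp: less_Suc_eq_le)
  define A where "A = X \<inter> {b..<b+m}"
  define u v where "u = Min A" and "v = Max A"
  have cA: "4 * int (card A) \<ge> p + 2 * e + 20" using b[of a] w by (simp add: A_def f_def)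
  then have ne: "A \<noteq> {}" "finite A" using e p_pos by (auto simp: A_def)
  have uv: "u \<in> A" "v \<in> A" "A \<subseteq> {u..v}" using ne by (auto simp: u_def v_def)
  have AX: "A = X \<inter> {u..v}" using uv by (auto simp: A_def)
  have "v - u < m" using uv(1,2) by (auto simp: A_def)
  then have d: "densest A u v" using uv AX b by (auto simp: densest_def f_def A_def[symmetric])
  obtain j where j: "u + v = j * p" using densest_centre[OF d e cA] by blast
  define i where "i = - (j div 2)"
  have d': "densest ((\<lambda>x. x + i * p) ` A) (u + i * p) (v + i * p)" by (rule densest_translate[OF d])
  have cA': "4 * int (card ((\<lambda>x. x + i * p) ` A)) \<ge> p + 2 * e + 20" using cA by (simp add: card_image)
  have "(u + i * p) + (v + i * p) = (j mod 2) * p"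
    using j by (simp add: i_def algebra_simps minus_mult_div_eq_mod[symmetric])
  moreover have "(u + i * p) + (v + i * p) \<noteq> 0" by (rule densest_not_centred_at_0[OF d' e cA'])
  moreover have "j mod 2 = 0 \<or> j mod 2 = 1" by auto
  ultimately have sum: "(u + i * p) + (v + i * p) = p" by auto
  have mid: "X \<inter> {0..<p} \<subseteq> {u + i * p..v + i * p}" by (rule densest_centred_at_half[OF d' e cA' sum])
  have L: "(v + i * p) - (u + i * p) \<le> p - period_card - int (card ((\<lambda>x. x + i * p) ` A))"
    using densest_sumset(4)[OF d'] cA' e p_eq m_pos by auto
  have "(\<lambda>x. x + i * p) ` A = X \<inter> {u + i * p..v + i * p}" using d' by (simp add: densest_def)
  then have "card (X \<inter> {0..<p}) \<le> card ((\<lambda>x. x + i * p) ` A)"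
    using mid by (intro card_mono) auto
  then show ?thesis using mid L sum by (fastforce simp: period_card_def)
qed

end

section \<open>Cosine sums\<close>

lemma sum_cos_multiples:
  fixes P :: nat and x :: int
  assumes "P > 0"
  shows "(\<Sum>\<xi><P. cos (2 * pi * real \<xi> * real_of_int x / real P)) = (if int P dvd x then real P else 0)"
proof -
  define z where "z = cis (2 * pi * real_of_int x / real P)"
  have pow: "z ^ \<xi> = cis (2 * pi * real \<xi> * real_of_int x / real P)" for \<xi>
    by (simp add: z_def DeMoivre mult_ac)
  have Re: "(\<Sum>\<xi><P. cos (2 * pi * real \<xi> * real_of_int x / real P)) = Re (\<Sum>\<xi><P. z ^ \<xi>)"
    by (simp add: pow)
  show ?thesis
  proof (cases "int P dvd x")
    case True
    then obtain k where k: "x = int P * k" by (auto simp: dvd_def)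
    have "cos (2 * pi * real \<xi> * real_of_int x / real P) = 1" for \<xi>
      unfolding cos_one_2pi_int using assms
      by (intro exI[of _ "int \<xi> * k"]) (simp add: k mult_ac)
    then show ?thesis using True by simp
  next
    case False
    have "z \<noteq> 1"
    proof
      assume "z = 1"
      then have "cos (2 * pi * real_of_int x / real P) = 1" by (simp add: z_def complex_eq_iff)
      then obtain n :: int where "2 * pi * real_of_int x / real P = real_of_int n * 2 * pi"
        unfolding cos_one_2pi_int by blast
      then have "real_of_int x = real_of_int (int P * n)" using assms by (simp add: field_simps)
      then have "x = int P * n" by linarith
      then show False using False by simp
    qed
    have "2 * pi * real P * real_of_int x / real P = 2 * pi * real_of_int x" using assms by simp
    then have "z ^ P = cis (2 * pi * real_of_int x)" by (simp only: pow)
    then have "z ^ P = 1"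
      using sin_int_2pin[of x] cos_int_2pin[of x] by (simp add: complex_eq_iff)
    then have "(\<Sum>\<xi><P. z ^ \<xi>) = 0" using geometric_sum[OF \<open>z \<noteq> 1\<close>, of P] by simp
    then show ?thesis using Re False by simp
  qed
qed

text \<open>
  The cosine sums \<open>c \<xi>\<close> are the Fourier coefficients of \<open>S\<close>, real by symmetry. Orthogonality
  gives \<open>(\<Sum>\<xi><P. c \<xi> ^ 2) = P * n\<close> for \<open>n = card S\<close>, and \<open>(\<Sum>\<xi><P. c \<xi> ^ 3) = 0\<close> because no three
  elements of \<open>S\<close> sum to 0. As \<open>c 0 = n\<close>, some other coefficient has to be at most
  \<open>- n\<^sup>2 / (P - n)\<close>, which is about \<open>- P / 6\<close> when \<open>n\<close> is about \<open>P / 3\<close>.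
\<close>

lemma exists_negative_cosine_sum:
  fixes P :: nat and S :: "int set"
  defines "c \<xi> \<equiv> \<Sum>s\<in>S. cos (2 * pi * real \<xi> * real_of_int s / real P)"
  assumes P: "P > 0" and S: "S \<subseteq> {0..<int P}" "S \<noteq> {}"
    and sym: "\<And>s. s \<in> S \<Longrightarrow> int P - s \<in> S"
    and free: "\<And>a b d. a \<in> S \<Longrightarrow> b \<in> S \<Longrightarrow> d \<in> S \<Longrightarrow> \<not> int P dvd a + b + d"
  shows "\<exists>\<xi>\<in>{1..<P}. c \<xi> * (real P - real (card S)) \<le> - (real (card S))\<^sup>2"
proof (rule ccontr)
  define n where "n = real (card S)"
  have fin: "finite S" using S(1) finite_subset by blast
  have n: "n > 0" using S(2) fin by (simp add: n_def card_gt_0_iff)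
  define \<theta> where "\<theta> \<xi> x = 2 * pi * real \<xi> * real_of_int x / real P" for \<xi> :: nat and x :: int
  have \<theta>_add: "\<theta> \<xi> (x + y) = \<theta> \<xi> x + \<theta> \<xi> y" for \<xi> x y
    by (simp add: \<theta>_def add_divide_distrib ring_distribs)
  have c_eq: "c \<xi> = (\<Sum>s\<in>S. cos (\<theta> \<xi> s))" for \<xi> by (simp add: c_def \<theta>_def)
  have bij: "bij_betw (\<lambda>s. int P - s) S S"
    by (rule bij_betwI[where g = "\<lambda>s. int P - s"]) (use sym in auto)
  have sin0: "(\<Sum>s\<in>S. sin (\<theta> \<xi> s)) = 0" for \<xi>
  proof -
    have "(\<Sum>s\<in>S. sin (\<theta> \<xi> s)) = (\<Sum>s\<in>S. sin (\<theta> \<xi> (int P - s)))"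
      by (rule sum.reindex_bij_betw[OF bij, symmetric])
    also have "\<dots> = (\<Sum>s\<in>S. - sin (\<theta> \<xi> s))"
    proof (rule sum.cong)
      fix s
      have "\<theta> \<xi> (int P - s) = 2 * pi * real \<xi> - \<theta> \<xi> s"
        using P by (simp add: \<theta>_def field_simps)
      moreover have "sin (2 * pi * real \<xi>) = 0" "cos (2 * pi * real \<xi>) = 1"
        using sin_int_2pin[of "int \<xi>"] cos_int_2pin[of "int \<xi>"] by simp_all
      ultimately show "sin (\<theta> \<xi> (int P - s)) = - sin (\<theta> \<xi> s)" by (simp add: sin_diff)
    qed simp
    finally show ?thesis by (simp add: sum_negf)
  qed
  have shift: "(\<Sum>s\<in>S. cos (\<theta> \<xi> (x + s))) = cos (\<theta> \<xi> x) * c \<xi>" for \<xi> x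
    using sin0[of \<xi>]
    by (simp add: \<theta>_add cos_add sum_subtractf c_eq sum_distrib_left[symmetric])
  have sq: "c \<xi> ^ 2 = (\<Sum>a\<in>S. \<Sum>b\<in>S. cos (\<theta> \<xi> (a + b)))" for \<xi>
    by (simp add: shift power2_eq_square sum_distrib_right[symmetric]) (simp add: c_eq)
  have cube: "c \<xi> ^ 3 = (\<Sum>a\<in>S. \<Sum>b\<in>S. \<Sum>d\<in>S. cos (\<theta> \<xi> (a + b + d)))" for \<xi>
    by (simp add: shift power3_eq_cube sum_distrib_right[symmetric]) (simp add: c_eq)
  have orth: "(\<Sum>\<xi><P. cos (\<theta> \<xi> x)) = (if int P dvd x then real P else 0)" for x
    unfolding \<theta>_def by (rule sum_cos_multiples[OF P])
  have "(\<Sum>\<xi><P. c \<xi> ^ 2) = (\<Sum>a\<in>S. \<Sum>b\<in>S. \<Sum>\<xi><P. cos (\<theta> \<xi> (a + b)))"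
    unfolding sq by (subst sum.swap, rule sum.cong[OF refl], subst sum.swap, rule refl)
  also have "\<dots> = (\<Sum>a\<in>S. \<Sum>b\<in>S. if b = int P - a then real P else 0)"
  proof (intro sum.cong refl)
    fix a b assume ab: "a \<in> S" "b \<in> S"
    have "int P dvd a + b \<longleftrightarrow> b = int P - a"
    proof
      assume "int P dvd a + b"
      then obtain k where k: "a + b = int P * k" by (auto simp: dvd_def)
      have "a \<noteq> 0" "b \<noteq> 0" using free[of a a a] free[of b b b] ab by auto
      moreover have "a \<in> {0..<int P}" "b \<in> {0..<int P}" using ab S(1) by blast+
      ultimately have "int P * 0 < int P * k" "int P * k < int P * 2"
        using k unfolding atLeastLessThan_iff by linarith+
      moreover have "int P > 0" using P by simp
      ultimately have "0 < k" "k < 2" using mult_less_cancel_left_pos by blast+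
      then have "k = 1" by linarith
      then show "b = int P - a" using k by simp
    qed simp
    then show "(\<Sum>\<xi><P. cos (\<theta> \<xi> (a + b))) = (if b = int P - a then real P else 0)"
      by (simp add: orth)
  qed
  also have "\<dots> = real P * n"
    using fin sym by (simp add: sum.delta n_def)
  finally have sum2: "(\<Sum>\<xi><P. c \<xi> ^ 2) = real P * n" .
  have "(\<Sum>\<xi><P. c \<xi> ^ 3) = (\<Sum>a\<in>S. \<Sum>b\<in>S. \<Sum>d\<in>S. \<Sum>\<xi><P. cos (\<theta> \<xi> (a + b + d)))"
    unfolding cube
    by (subst sum.swap, rule sum.cong[OF refl], subst sum.swap, rule sum.cong[OF refl],
        subst sum.swap, rule refl)
  also have "\<dots> = 0" using free by (simp add: orth)
  finally have sum3: "(\<Sum>\<xi><P. c \<xi> ^ 3) = 0" .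
  have c0: "c 0 = n" by (simp add: c_def n_def)
  have split: "(\<Sum>\<xi><P. f \<xi>) = f 0 + (\<Sum>\<xi>\<in>{1..<P}. f \<xi>)" for f :: "nat \<Rightarrow> real"
    using P by (simp add: lessThan_atLeast0 sum.atLeast_Suc_lessThan)
  have s2: "(\<Sum>\<xi>\<in>{1..<P}. c \<xi> ^ 2) = real P * n - n ^ 2" using sum2 split[of "\<lambda>\<xi>. c \<xi> ^ 2"] c0 by simp
  have s3: "(\<Sum>\<xi>\<in>{1..<P}. c \<xi> ^ 3) = - (n ^ 3)" using sum3 split[of "\<lambda>\<xi>. c \<xi> ^ 3"] c0 by simp
  assume "\<not> ?thesis"
  then have pos: "c \<xi> * (real P - n) + n ^ 2 > 0" if "\<xi> \<in> {1..<P}" for \<xi>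
    using that by (force simp: n_def)
  have "(\<Sum>\<xi>\<in>{1..<P}. c \<xi> ^ 2 * (c \<xi> * (real P - n) + n ^ 2))
      = (real P - n) * (\<Sum>\<xi>\<in>{1..<P}. c \<xi> ^ 3) + n ^ 2 * (\<Sum>\<xi>\<in>{1..<P}. c \<xi> ^ 2)"
    by (simp add: sum_distrib_left sum.distrib[symmetric] power2_eq_square power3_eq_cube algebra_simps)
  also have "\<dots> = 0" unfolding s2 s3 by (simp add: power2_eq_square power3_eq_cube algebra_simps)
  finally have "(\<Sum>\<xi>\<in>{1..<P}. c \<xi> ^ 2 * (c \<xi> * (real P - n) + n ^ 2)) = 0" .
  then have "\<forall>\<xi>\<in>{1..<P}. c \<xi> ^ 2 * (c \<xi> * (real P - n) + n ^ 2) = 0"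
  proof (subst (asm) sum_nonneg_eq_0_iff)
    show "0 \<le> c \<xi> ^ 2 * (c \<xi> * (real P - n) + n ^ 2)" if "\<xi> \<in> {1..<P}" for \<xi>
      using pos[OF that] by (intro mult_nonneg_nonneg) simp_all
  qed simp_all
  then have "\<forall>\<xi>\<in>{1..<P}. c \<xi> = 0" using pos by fastforce
  then show False using s3 n by simp
qed

lemma half_le_sin:
  fixes x :: real
  assumes "0 \<le> x" "x \<le> pi / 3"
  shows "x / 2 \<le> sin x"
proof -
  define f where "f y = sin y - y / 2" for y :: real
  have "f 0 \<le> f x"
  proof (rule DERIV_nonneg_imp_nondecreasing[OF assms(1)])
    fix y assume y: "0 \<le> y" "y \<le> x"
    have "cos (pi / 3) \<le> cos y" using y assms by (intro cos_monotone_0_pi_le) auto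
    then have "cos y - 1 / 2 \<ge> 0" by (simp add: cos_60)
    moreover have "(f has_real_derivative cos y - 1 / 2) (at y)"
      unfolding f_def by (auto intro!: derivative_eq_intros)
    ultimately show "\<exists>d. (f has_real_derivative d) (at y) \<and> d \<ge> 0" by blast
  qed
  then show ?thesis by (simp add: f_def)
qed

text \<open>
  The tetrahedral numbers, which measure the gain in \<open>cosine_sum_le\<close> below.
\<close>

lemma sum_triangle:
  fixes b :: nat
  shows "6 * (\<Sum>j<b. (real b - real j) * real j) = real b ^ 3 - real b"
proof -
  have "6 * (\<Sum>j<k. (x - real j) * real j) = 3 * x * (real k ^ 2 - real k) - (2 * real k ^ 3 - 3 * real k ^ 2 + real k)"
    for k :: nat and x :: real
    by (induction k) (simp_all add: algebra_simps power2_eq_square power3_eq_cube)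
  from this[where k = b and x = "real b"] show ?thesis by (simp add: algebra_simps power2_eq_square power3_eq_cube)
qed

text \<open>
  Here \<open>H\<close> lists the elements of a symmetric set to the right of \<open>p / 2\<close>, at the positions
  \<open>p / 2 + (i - 1/2)\<close>, and \<open>h j + h (m - j)\<close> is the number of elements in the half circle that starts \<open>j\<close>
  places to the left of \<open>p / 2\<close>. Summation by parts writes the cosine sum as an average of these
  numbers with nonnegative weights \<open>d j\<close>. Bounding all of them by \<open>M\<close> gives \<open>2 * M\<close>, as in Freiman's
  lemma on points in half circles. For the structure theorem this is just not enough. The cubic term is
  the improvement for points that are distinct integers: \<open>h j \<le> j\<close>, so for small \<open>j\<close> the
  half circle count stays below \<open>M\<close> by at least \<open>b - j\<close>.
\<close>

lemma cosine_sum_le: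
  fixes m b :: nat and H :: "nat set" and M :: real
  defines "p \<equiv> real (2 * m + 1)" and "h j \<equiv> card (H \<inter> {1..j})"
  assumes H: "H \<subseteq> {1..m}" and b: "12 * b \<le> 2 * m + 1"
    and arcs: "\<And>j. j \<le> m \<Longrightarrow> real (h j + h (m - j)) \<le> M"
    and bM: "real (card H) + real b \<le> M"
  shows "2 * (\<Sum>i\<in>H. cos (real (2 * i - 1) * pi / p) + 1) \<le> 2 * M + 8 - 3 / 2 * (real b ^ 3 - real b) / p\<^sup>2"
proof -
  have p: "p > 0" by (simp add: p_def)
  have finH: "finite H" using H finite_subset by blast
  define c where "c i = cos ((2 * real i - 1) * pi / p)" for i :: nat
  define d where "d j = c j - c (Suc j)" for j
  have d_eq: "d j = 2 * sin (pi / p) * sin (2 * real j * pi / p)" for j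
  proof -
    have eqs: "((2 * real j - 1) * pi / p + (2 * real (Suc j) - 1) * pi / p) / 2 = 2 * real j * pi / p"
      "((2 * real (Suc j) - 1) * pi / p - (2 * real j - 1) * pi / p) / 2 = pi / p"
      using p by (simp_all add: field_simps)
    show ?thesis unfolding d_def c_def cos_diff_cos eqs by (simp only: mult_ac)
  qed
  have cm: "c (Suc m) = - 1" using p by (simp add: c_def p_def)
  have tele: "(\<Sum>j\<in>{i..m}. d j) = c i + 1" if "i \<le> Suc m" for i
    using sum_Suc_diff[of i m "\<lambda>j. - c j"] that cm by (simp add: d_def)
  have s1: "sin (pi / p) \<ge> 0" "sin (pi / p) \<le> pi / p"
  proof -
    have x: "0 \<le> pi / p" "pi / p \<le> pi" using p by (simp_all add: p_def field_simps)
    show "sin (pi / p) \<ge> 0" by (rule sin_ge_zero[OF x])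
    show "sin (pi / p) \<le> pi / p" by (rule sin_x_le_x[OF x(1)])
  qed
  have s2: "sin (2 * real j * pi / p) \<ge> 0" if "j \<le> m" for j
  proof (rule sin_ge_zero)
    have "2 * real j * pi \<le> p * pi" using that by (intro mult_right_mono) (auto simp: p_def)
    then show "2 * real j * pi / p \<le> pi" using p by (simp add: divide_le_eq mult_ac)
  qed (use p in simp)
  have d_nonneg: "d j \<ge> 0" if "j \<le> m" for j using s1 s2[OF that] by (simp add: d_eq)
  have "(\<Sum>i\<in>H. c i + 1) = (\<Sum>i\<in>H. \<Sum>j\<in>{0..m}. if i \<le> j then d j else 0)"
  proof (rule sum.cong[OF refl])
    fix i assume "i \<in> H"
    then have "c i + 1 = (\<Sum>j\<in>{i..m}. d j)" using tele H by fastforce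
    also have "\<dots> = (\<Sum>j\<in>{0..m}. if i \<le> j then d j else 0)"
      by (rule sum.mono_neutral_cong_left) auto
    finally show "c i + 1 = (\<Sum>j\<in>{0..m}. if i \<le> j then d j else 0)" .
  qed
  also have "\<dots> = (\<Sum>j\<in>{0..m}. real (h j) * d j)"
  proof (subst sum.swap, rule sum.cong[OF refl])
    fix j
    have "H \<inter> {1..j} = {i \<in> H. i \<le> j}" using H by auto
    then show "(\<Sum>i\<in>H. if i \<le> j then d j else 0) = real (h j) * d j"
      using finH by (simp add: h_def sum.If_cases Int_def)
  qed
  finally have abel: "(\<Sum>i\<in>H. c i + 1) = (\<Sum>j\<in>{0..m}. real (h j) * d j)" .
  have rev: "(\<Sum>j\<in>{0..m}. real (h j) * d j) = (\<Sum>j\<in>{0..m}. real (h (m - j)) * d (m - j))"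
    by (rule sum.reindex_bij_witness[of _ "\<lambda>j. m - j" "\<lambda>j. m - j"]) auto
  define \<delta> where "\<delta> = 2 * (pi / p) ^ 2"
  \<comment> \<open>The weights at \<open>j\<close> and \<open>m - j\<close> agree up to \<open>O(1 / p\<^sup>2)\<close>, which costs a constant in total.\<close>
  have dd: "d (m - j) \<le> d j + \<delta>" if "j \<le> m" for j
  proof -
    have "2 * real (m - j) * pi / p = pi - (2 * real j + 1) * pi / p"
      using that p by (simp add: p_def field_simps of_nat_diff)
    then have "sin (2 * real (m - j) * pi / p) = sin ((2 * real j + 1) * pi / p)" by simp
    also have "\<dots> = sin (2 * real j * pi / p + pi / p)" by (simp add: add_divide_distrib ring_distribs)
    also have "\<dots> \<le> sin (2 * real j * pi / p) + sin (pi / p)"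
      using mult_left_le[OF cos_le_one s2[OF that], of "pi / p"]
        mult_left_le[OF cos_le_one s1(1), of "2 * real j * pi / p"]
      unfolding sin_add by (simp add: mult.commute)
    finally have "d (m - j) \<le> 2 * sin (pi / p) * (sin (2 * real j * pi / p) + sin (pi / p))"
      unfolding d_eq using s1 by (intro mult_left_mono) auto
    also have "\<dots> = d j + 2 * (sin (pi / p))\<^sup>2" by (simp add: d_eq algebra_simps power2_eq_square)
    also have "(sin (pi / p))\<^sup>2 \<le> (pi / p)\<^sup>2" using s1 by (intro power_mono) auto
    finally show ?thesis by (simp add: \<delta>_def)
  qed
  have h_le_j: "h j \<le> j" for j using card_mono[of "{1..j}" "H \<inter> {1..j}"] by (simp add: h_def)
  have h_le: "h j \<le> card H" for j unfolding h_def using finH by (intro card_mono) auto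
  have M0: "M \<ge> 0" using bM by (smt (verit) of_nat_0_le_iff)
  define D where "D j = (if j < b then real b - real j else 0)" for j
  have summand: "real (h j) * d j + real (h (m - j)) * d (m - j) \<le> M * d j - D j * d j + real m * \<delta>"
    if j: "j \<le> m" for j
  proof -
    have \<delta>0: "\<delta> \<ge> 0" by (simp add: \<delta>_def)
    have "real (h (m - j)) * d (m - j) \<le> real (h (m - j)) * (d j + \<delta>)"
      using dd[OF j] by (intro mult_left_mono) auto
    moreover have "real (h (m - j)) * \<delta> \<le> real m * \<delta>"
      using h_le_j[of "m - j"] \<delta>0 by (intro mult_right_mono) auto
    moreover have "real (h j + h (m - j)) \<le> M - D j"
      using arcs[OF j] h_le_j[of j] h_le[of "m - j"] bM by (auto simp: D_def)
    then have "real (h j + h (m - j)) * d j \<le> (M - D j) * d j"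
      using d_nonneg[OF j] by (intro mult_right_mono)
    ultimately show ?thesis by (simp add: algebra_simps)
  qed
  have "2 * (\<Sum>i\<in>H. c i + 1) = (\<Sum>j\<in>{0..m}. real (h j) * d j + real (h (m - j)) * d (m - j))"
    using abel rev by (simp add: sum.distrib)
  also have "\<dots> \<le> (\<Sum>j\<in>{0..m}. M * d j - D j * d j + real m * \<delta>)"
    by (intro sum_mono summand) auto
  finally have total: "2 * (\<Sum>i\<in>H. c i + 1)
      \<le> (\<Sum>j\<in>{0..m}. M * d j - D j * d j + real m * \<delta>)" .
  have expand: "(\<Sum>j\<in>{0..m}. M * d j - D j * d j + real m * \<delta>)
      = M * (\<Sum>j\<in>{0..m}. d j) - (\<Sum>j\<in>{0..m}. D j * d j) + real (m + 1) * (real m * \<delta>)"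
    by (simp add: sum.distrib sum_subtractf sum_distrib_left)
  have main: "M * (\<Sum>j\<in>{0..m}. d j) \<le> M * 2"
    using tele[of 0] M0 by (intro mult_left_mono) (auto simp: c_def)
  have error: "real (m + 1) * (real m * \<delta>) \<le> 8"
  proof -
    have "real (m + 1) * real m \<le> p\<^sup>2 / 4" by (simp add: p_def power2_eq_square algebra_simps)
    then have "(real (m + 1) * real m) * \<delta> \<le> p\<^sup>2 / 4 * \<delta>"
      by (intro mult_right_mono) (auto simp: \<delta>_def)
    also have "\<dots> = pi\<^sup>2 / 2" using p by (simp add: \<delta>_def power_divide)
    also have "\<dots> \<le> 4\<^sup>2 / 2" using pi_less_4 by (intro divide_right_mono power_mono) auto
    also have "\<dots> = 8" by (simp add: power2_eq_square)
    finally show ?thesis by (simp add: mult_ac)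
  qed
  have gain: "(\<Sum>j\<in>{0..m}. D j * d j) \<ge> (\<Sum>j<b. (real b - real j) * (9 * real j / p\<^sup>2))"
  proof -
    have "(\<Sum>j\<in>{0..m}. D j * d j) = (\<Sum>j<b. (real b - real j) * d j)"
      using b by (intro sum.mono_neutral_cong_right) (auto simp: D_def)
    moreover have "9 * real j / p\<^sup>2 \<le> d j" if "j < b" for j
    proof -
      have "pi / p / 2 \<le> sin (pi / p)"
        using p b that by (intro half_le_sin) (auto simp: p_def field_simps)
      moreover have "(2 * real j * pi / p) / 2 \<le> sin (2 * real j * pi / p)"
      proof (rule half_le_sin)
        have "12 * j \<le> 2 * m + 1" using b that by linarith
        then have "6 * real j \<le> p" unfolding p_def by linarith
        then have "6 * real j * pi \<le> p * pi" by (intro mult_right_mono) auto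
        then show "2 * real j * pi / p \<le> pi / 3" using p by (simp add: field_simps)
      qed (use p in simp)
      ultimately have "2 * (pi / p / 2) * ((2 * real j * pi / p) / 2) \<le> d j"
        unfolding d_eq using p s1 by (intro mult_mono) auto
      moreover have "2 * (pi / p / 2) * ((2 * real j * pi / p) / 2) = pi\<^sup>2 * real j / p\<^sup>2"
        using p by (simp add: power2_eq_square)
      moreover have "3\<^sup>2 \<le> pi\<^sup>2" using sin_x_le_x[of "pi / 6"] by (intro power_mono) (simp_all add: sin_30)
      then have "9 * real j / p\<^sup>2 \<le> pi\<^sup>2 * real j / p\<^sup>2"
        using p by (intro divide_right_mono mult_right_mono) auto
      ultimately show ?thesis by linarith
    qed
    ultimately show ?thesis by (simp only:) (intro sum_mono mult_left_mono, simp_all)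
  qed
  have gain_eq: "(\<Sum>j<b. (real b - real j) * (9 * real j / p\<^sup>2)) = 3 / 2 * (real b ^ 3 - real b) / p\<^sup>2"
  proof -
    have "(\<Sum>j<b. (real b - real j) * (9 * real j / p\<^sup>2)) = 9 / p\<^sup>2 * (\<Sum>j<b. (real b - real j) * real j)"
      unfolding sum_distrib_left by (rule sum.cong) (simp_all only: mult_ac times_divide_eq_left times_divide_eq_right)
    then show ?thesis unfolding sum_triangle[symmetric] by simp
  qed
  have "2 * (\<Sum>i\<in>H. c i + 1) \<le> M * 2 - 3 / 2 * (real b ^ 3 - real b) / p\<^sup>2 + 8"
    using total expand main error gain gain_eq by linarith
  moreover have "(\<Sum>i\<in>H. c i + 1) = (\<Sum>i\<in>H. cos (real (2 * i - 1) * pi / p) + 1)"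
    using H by (intro sum.cong) (auto simp: c_def of_nat_diff)
  ultimately show ?thesis by simp
qed

section \<open>Dilation into the middle third\<close>

definition dilate :: "int \<Rightarrow> int set \<Rightarrow> int set" where
  "dilate d X = {x. d * x \<in> X}"

lemma prime_inverse_mod:
  fixes p d :: int
  assumes "prime p" "\<not> p dvd d"
  shows "\<exists>e\<in>{1..<p}. (d * e) mod p = 1"
proof -
  have "coprime d p" using prime_imp_coprime[OF assms] by (simp add: coprime_commute)
  then obtain e where e: "[d * e = 1] (mod p)" using cong_solve_coprime_int by blast
  have p1: "p > 1" using assms(1) prime_gt_1_int by blast
  have "(d * (e mod p)) mod p = 1" using e p1 by (simp add: cong_def mod_mult_right_eq)
  moreover from this have "e mod p \<noteq> 0" using p1 by (intro notI) simp
  moreover have "0 \<le> e mod p" "e mod p < p" using p1 by simp_all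
  ultimately show ?thesis by (intro bexI[of _ "e mod p"]) auto
qed

lemma mult_inverse_mod:
  fixes p d e x :: int
  assumes "(d * e) mod p = 1"
  shows "(d * (e * x)) mod p = x mod p"
proof -
  have "(d * (e * x)) mod p = ((d * e) mod p * x) mod p" by (simp add: mod_mult_left_eq mult.assoc)
  then show ?thesis using assms by simp
qed

context sym_sum_free
begin

lemma sym_sum_free_dilate: "sym_sum_free p m (dilate d X)"
proof
  show "x + j * p \<in> dilate d X" if "x \<in> dilate d X" for x j
    using that periodic[of "d * x" "d * j"] by (simp add: dilate_def algebra_simps)
  show "- x \<in> dilate d X" if "x \<in> dilate d X" for x
    using that sym by (simp add: dilate_def)
  show "x + y \<notin> dilate d X" if "x \<in> dilate d X" "y \<in> dilate d X" for x y
    using that sum_free by (simp add: dilate_def distrib_left)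
qed (fact p_eq m_pos)+

lemma cong_iff: "x mod p = y mod p \<Longrightarrow> x \<in> X \<longleftrightarrow> y \<in> X"
  using mod_iff[of x] mod_iff[of y] by simp

lemma bij_betw_dilate:
  assumes de: "(d * e) mod p = 1"
  shows "bij_betw (\<lambda>s. (e * s) mod p) (X \<inter> {0..<p}) (dilate d X \<inter> {0..<p})"
proof (rule bij_betwI[where g = "\<lambda>x. (d * x) mod p"])
  have "(e * d) mod p = 1" using de by (simp add: mult.commute)
  then have de': "(d * (e * s)) mod p = s mod p" "(e * (d * s)) mod p = s mod p" for s
    using de by (simp_all add: mult_inverse_mod)
  show "(\<lambda>s. (e * s) mod p) \<in> X \<inter> {0..<p} \<rightarrow> dilate d X \<inter> {0..<p}"
  proof
    fix s assume s: "s \<in> X \<inter> {0..<p}"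
    have "(d * ((e * s) mod p)) mod p = s mod p" using de'[of s] by (simp add: mod_mult_right_eq)
    then have "d * ((e * s) mod p) \<in> X" using cong_iff s by blast
    then show "(e * s) mod p \<in> dilate d X \<inter> {0..<p}" using p_pos by (simp add: dilate_def)
  qed
  show "(\<lambda>x. (d * x) mod p) \<in> dilate d X \<inter> {0..<p} \<rightarrow> X \<inter> {0..<p}"
    using p_pos by (auto simp: dilate_def mod_iff)
  show "(d * ((e * s) mod p)) mod p = s" if "s \<in> X \<inter> {0..<p}" for s
    using that de'[of s] by (simp add: mod_mult_right_eq)
  show "(e * ((d * x) mod p)) mod p = x" if "x \<in> dilate d X \<inter> {0..<p}" for x
    using that de'[of x] by (simp add: mod_mult_right_eq)
qed

lemma period_card_dilate:
  assumes "(d * e) mod p = 1"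
  shows "sym_sum_free.period_card p (dilate d X) = period_card"
  using bij_betw_same_card[OF bij_betw_dilate[OF assms]]
    sym_sum_free.period_card_def[OF sym_sum_free_dilate] period_card_def by simp

definition upper_half :: "nat set" where
  "upper_half = {i \<in> {1..nat m}. m + int i \<in> X}"

lemma card_upper_half_segment:
  assumes "j \<le> nat m"
  shows "card (upper_half \<inter> {1..j}) = card (X \<inter> {m+1..m + int j})"
  by (rule bij_betw_same_card[of "\<lambda>i. m + int i"], rule bij_betwI[where g = "\<lambda>x. nat (x - m)"])
     (use assms in \<open>auto simp: upper_half_def\<close>)

lemma card_reflected_segment:
  "card (X \<inter> {m+1-j..m}) = card (X \<inter> {m+1..m+j})"
  by (rule bij_betw_same_card[of "\<lambda>x. p - x"], rule bij_betwI[where g = "\<lambda>x. p - x"])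
     (auto simp: reflect, auto simp: p_eq)

lemma card_upper_half: "2 * card upper_half = nat period_card"
proof -
  have "upper_half = upper_half \<inter> {1..nat m}" by (auto simp: upper_half_def)
  then have "card upper_half = card (X \<inter> {m+1..2*m})"
    using card_upper_half_segment[of "nat m"] m_pos by simp
  also have "\<dots> = card (X \<inter> {1..m})" using card_reflected_segment[of m] by simp
  finally show ?thesis using card_half_period by simp
qed

text \<open>
  The part of the window to the left of \<open>p / 2\<close> is reflected to the right.
\<close>

lemma card_centred_window:
  assumes "j \<le> nat m"
  shows "card (X \<inter> {m+1 - int j..<m+1 - int j + m})
    = card (upper_half \<inter> {1..j}) + card (upper_half \<inter> {1..nat m - j})"
proof -
  have "X \<inter> {m+1 - int j..<m+1 - int j + m} = (X \<inter> {m+1 - int j..m}) \<union> (X \<inter> {m+1..m + int (nat m - j)})"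
    using assms by (auto simp: of_nat_diff)
  then have "card (X \<inter> {m+1 - int j..<m+1 - int j + m})
      = card (X \<inter> {m+1 - int j..m}) + card (X \<inter> {m+1..m + int (nat m - j)})"
    by (simp only:) (rule card_Un_disjoint, auto)
  then show ?thesis
    using assms card_upper_half_segment[of j] card_upper_half_segment[of "nat m - j"]
      card_reflected_segment[of "int j"] by simp
qed

lemma sum_cos_period:
  "(\<Sum>s\<in>X \<inter> {0..<p}. cos (2 * pi * real_of_int s / real_of_int p))
    = - 2 * (\<Sum>i\<in>upper_half. cos (real (2 * i - 1) * pi / real_of_int p))"
proof -
  let ?c = "\<lambda>s. cos (2 * pi * real_of_int s / real_of_int p)"
  have split: "X \<inter> {0..<p} = (X \<inter> {1..m}) \<union> (X \<inter> {m+1..2*m})"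
  proof (intro equalityI subsetI)
    fix x assume "x \<in> X \<inter> {0..<p}"
    moreover from this have "x \<noteq> 0" using zero_notin by auto
    ultimately show "x \<in> (X \<inter> {1..m}) \<union> (X \<inter> {m+1..2*m})" by (auto simp: p_eq)
  qed (auto simp: p_eq)
  have "(\<Sum>s\<in>X \<inter> {1..m}. ?c s) = (\<Sum>s\<in>X \<inter> {m+1..2*m}. ?c s)"
  proof (rule sum.reindex_bij_witness[of _ "\<lambda>x. p - x" "\<lambda>x. p - x"])
    fix s
    have "2 * pi * real_of_int (p - s) / real_of_int p = 2 * pi - 2 * pi * real_of_int s / real_of_int p"
      using p_pos by (simp add: field_simps)
    then show "?c (p - s) = ?c s" by simp
  qed (auto simp: reflect, auto simp: p_eq)
  then have "(\<Sum>s\<in>X \<inter> {0..<p}. ?c s) = 2 * (\<Sum>s\<in>X \<inter> {m+1..2*m}. ?c s)"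
    unfolding split by (subst sum.union_disjoint) auto
  also have "(\<Sum>s\<in>X \<inter> {m+1..2*m}. ?c s) = (\<Sum>i\<in>upper_half. - cos (real (2 * i - 1) * pi / real_of_int p))"
  proof (rule sum.reindex_bij_witness[of _ "\<lambda>i. m + int i" "\<lambda>x. nat (x - m)"])
    fix s assume s: "s \<in> X \<inter> {m+1..2*m}"
    define i where "i = nat (s - m)"
    have i: "s = m + int i" "i \<ge> 1" using s by (auto simp: i_def)
    have "real (2 * i - 1) = 2 * real i - 1" using i(2) by (simp add: of_nat_diff)
    then have "real (2 * nat (s - m) - 1) = 2 * real_of_int (s - m) - 1"
      using i(1) by (simp add: i_def[symmetric])
    then have "2 * pi * real_of_int s / real_of_int p = real (2 * nat (s - m) - 1) * pi / real_of_int p + pi"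
      using m_pos by (simp add: p_eq field_simps)
    then show "- cos (real (2 * nat (s - m) - 1) * pi / real_of_int p) = ?c s" by simp
  qed (auto simp: upper_half_def)
  finally show ?thesis by (simp add: sum_negf)
qed

text \<open>
  Suppose every window contains at most \<open>P / 4 + P / 8000\<close> elements. With \<open>b\<close> about \<open>P / 12\<close>, the largest
  value that the hypothesis \<open>n / 2 + b \<le> M\<close> of \<open>cosine_sum_le\<close> permits, that lemma bounds \<open>n\<close> minus the
  coefficient by \<open>0.4995 * P\<close>. By assumption the same quantity is at least \<open>n * P / (P - n)\<close>, which
  tends to \<open>P / 2\<close> when \<open>n\<close> tends to \<open>P / 3\<close>.
\<close>

lemma dense_window_of_coefficient:
  assumes big: "p \<ge> 1000000"
    and n: "real_of_int period_card \<le> real_of_int p / 3"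
      "real_of_int period_card \<ge> (1/3 - 1/20000) * real_of_int p"
    and coeff: "(\<Sum>s\<in>X \<inter> {0..<p}. cos (2 * pi * real_of_int s / real_of_int p))
        * (real_of_int p - real_of_int period_card) \<le> - (real_of_int period_card)\<^sup>2"
  shows "\<exists>a. 4 * real (card (X \<inter> {a..<a+m})) \<ge> real_of_int p + real_of_int p / 2000"
proof (rule ccontr)
  define P n where "P = real_of_int p" and "n = real_of_int period_card"
  assume "\<not> ?thesis"
  then have win: "real (card (X \<inter> {a..<a+m})) \<le> P / 4 + P / 8000" for a
    by (simp add: not_le P_def) (smt (verit))
  have P: "P \<ge> 1000000" using big by (simp add: P_def)
  have nn: "n \<le> P / 3" "n \<ge> (1/3 - 1/20000) * P" "n > 0" using n P by (auto simp: n_def P_def)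
  define b where "b = nat (p div 12)"
  have "12 * (p div 12) \<le> p" "p < 12 * (p div 12) + 12" "p div 12 \<ge> 0" using big by auto
  then have "12 * int b \<le> p" "p < 12 * int b + 12" by (simp_all add: b_def)
  then have b: "12 * real b \<le> P" "P \<le> 12 * real b + 12" by (simp_all add: P_def)
  have p_nat: "real (2 * nat m + 1) = P" using m_pos by (simp add: P_def p_eq)
  have cH: "real (card upper_half) = n / 2"
    using card_upper_half m_pos by (simp add: n_def period_card_def)
  define C where "C = (\<Sum>i\<in>upper_half. cos (real (2 * i - 1) * pi / P))"
  have "2 * (\<Sum>i\<in>upper_half. cos (real (2 * i - 1) * pi / real (2 * nat m + 1)) + 1)
      \<le> 2 * (P / 4 + P / 8000) + 8 - 3 / 2 * (real b ^ 3 - real b) / (real (2 * nat m + 1))\<^sup>2"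
  proof (rule cosine_sum_le)
    show "upper_half \<subseteq> {1..nat m}" by (auto simp: upper_half_def)
    show "12 * b \<le> 2 * nat m + 1" using b p_nat by linarith
    show "real (card (upper_half \<inter> {1..j}) + card (upper_half \<inter> {1..nat m - j})) \<le> P / 4 + P / 8000"
      if "j \<le> nat m" for j
      using win[of "m + 1 - int j"] card_centred_window[OF that] by simp
    show "real (card upper_half) + real b \<le> P / 4 + P / 8000" using cH b nn P by simp
  qed
  then have up: "2 * C + n \<le> P / 2 + P / 4000 + 8 - 3 / 2 * (real b ^ 3 - real b) / P\<^sup>2"
    using cH unfolding p_nat by (simp add: C_def sum.distrib)
  \<comment> \<open>The rounding in \<open>b\<close> costs less than the step from 12 to 12.01.\<close>
  have b12: "real b \<ge> P / 12.01" using b P by simp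
  have "real b ^ 3 - real b \<ge> (P / 12.01) ^ 3 - P / 12"
    using b b12 P by (intro diff_mono power_mono) auto
  then have "(real b ^ 3 - real b) / P\<^sup>2 \<ge> ((P / 12.01) ^ 3 - P / 12) / P\<^sup>2"
    by (intro divide_right_mono) auto
  also have "((P / 12.01) ^ 3 - P / 12) / P\<^sup>2 = P / 12.01 ^ 3 - 1 / (12 * P)"
    using P by (simp add: field_simps power2_eq_square power3_eq_cube)
  finally have "(real b ^ 3 - real b) / P\<^sup>2 \<ge> P / 12.01 ^ 3 - 1 / (12 * P)" .
  moreover have "1 / (12 * P) \<le> 1 / 2" using P by (simp add: field_simps)
  moreover have "3 / 2 * (real b ^ 3 - real b) / P\<^sup>2 = 3 / 2 * ((real b ^ 3 - real b) / P\<^sup>2)" by simp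
  ultimately have gain: "3 / 2 * (real b ^ 3 - real b) / P\<^sup>2 \<ge> 3 / 2 * (P / 12.01 ^ 3) - 1"
    by linarith
  have "2 * C * (P - n) \<ge> n\<^sup>2" using coeff by (simp add: sum_cos_period C_def P_def n_def)
  then have low: "(2 * C + n) * (P - n) \<ge> n * P" by (simp add: algebra_simps power2_eq_square)
  have "2 * C + n \<le> 0.4995 * P" using up gain P by (simp add: power3_eq_cube)
  then have "(2 * C + n) * (P - n) \<le> (0.4995 * P) * (P - n)" using nn P by (intro mult_right_mono) auto
  then have "n * P \<le> (0.4995 * P) * (P - n)" using low by linarith
  then have "n * P \<le> (0.4995 * (P - n)) * P" by (simp add: mult_ac)
  then have "n \<le> 0.4995 * (P - n)" using P by (simp add: mult_le_cancel_right)
  then show False using nn P by simp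
qed

text \<open>
  Dilation permutes the Fourier coefficients, so the very negative coefficient can be moved to
  frequency 1, where it produces a window with more than a quarter of all residues.
\<close>

lemma exists_middle_dilate:
  assumes prime: "prime p" and big: "p \<ge> 1000000"
    and n: "real_of_int period_card \<le> real_of_int p / 3"
      "real_of_int period_card \<ge> (1/3 - 1/20000) * real_of_int p"
  shows "\<exists>d\<in>{1..<p}. dilate d X \<inter> {0..<p} \<subseteq> {period_card..p - period_card}"
proof -
  let ?P = "nat p"
  let ?S = "X \<inter> {0..<p}"
  have P: "real ?P = real_of_int p" "int ?P = p" "?P > 0" using big by auto
  have "real_of_int period_card > 0" using n big by auto
  then have "?S \<noteq> {}" by (auto simp: period_card_def)
  have "\<exists>\<xi>\<in>{1..<?P}. (\<Sum>s\<in>?S. cos (2 * pi * real \<xi> * real_of_int s / real ?P)) * (real ?P - real (card ?S))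
      \<le> - (real (card ?S))\<^sup>2"
  proof (rule exists_negative_cosine_sum)
    show "int ?P - s \<in> ?S" if "s \<in> ?S" for s
    proof -
      have "s \<noteq> 0" using that zero_notin by auto
      then show ?thesis using that by (auto simp: reflect P)
    qed
    show "\<not> int ?P dvd a + b + c" if "a \<in> ?S" "b \<in> ?S" "c \<in> ?S" for a b c
    proof
      assume "int ?P dvd a + b + c"
      then obtain k where "a + b + c = p * k" unfolding P dvd_def by blast
      then have "a + b = k * p - c" by (simp add: algebra_simps)
      then have "a + b \<in> X" using that(3) reflect_iff by simp
      then show False using sum_free that by auto
    qed
  qed (use P \<open>?S \<noteq> {}\<close> in auto)
  then obtain \<xi> where \<xi>: "\<xi> \<in> {1..<?P}"
    "(\<Sum>s\<in>?S. cos (2 * pi * real \<xi> * real_of_int s / real ?P)) * (real ?P - real (card ?S))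
      \<le> - (real (card ?S))\<^sup>2" by blast
  have "0 < int \<xi>" "int \<xi> < p" using \<xi>(1) by auto
  then have "\<not> p dvd int \<xi>" by (rule zdvd_not_zless)
  then obtain d where d: "d \<in> {1..<p}" "(int \<xi> * d) mod p = 1"
    using prime_inverse_mod[OF prime] by blast
  then have d\<xi>: "(d * int \<xi>) mod p = 1" by (simp add: mult.commute)
  interpret Y: sym_sum_free p m "dilate d X" by (rule sym_sum_free_dilate)
  have nY: "Y.period_card = period_card" by (rule period_card_dilate[OF d\<xi>])
  have "(\<Sum>s\<in>dilate d X \<inter> {0..<p}. cos (2 * pi * real_of_int s / real_of_int p))
      = (\<Sum>s\<in>?S. cos (2 * pi * real_of_int ((int \<xi> * s) mod p) / real_of_int p))"
    by (rule sum.reindex_bij_betw[OF bij_betw_dilate[OF d\<xi>], symmetric])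
  also have "\<dots> = (\<Sum>s\<in>?S. cos (2 * pi * real \<xi> * real_of_int s / real ?P))"
  proof (rule sum.cong[OF refl])
    fix s
    define q where "q = (int \<xi> * s) div p"
    have "int \<xi> * s = (int \<xi> * s) mod p + p * q" by (simp add: q_def)
    then have "real \<xi> * real_of_int s = real_of_int ((int \<xi> * s) mod p) + real_of_int p * real_of_int q"
      by (metis of_int_add of_int_mult of_int_of_nat_eq)
    moreover have "2 * pi * real \<xi> * real_of_int s / real ?P = 2 * pi * (real \<xi> * real_of_int s) / real_of_int p"
      using P by simp
    ultimately have "2 * pi * real \<xi> * real_of_int s / real ?P
        = 2 * pi * real_of_int ((int \<xi> * s) mod p) / real_of_int p + 2 * pi * real_of_int q"
      using big by (simp add: ring_distribs add_divide_distrib)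
    then show "cos (2 * pi * real_of_int ((int \<xi> * s) mod p) / real_of_int p)
        = cos (2 * pi * real \<xi> * real_of_int s / real ?P)"
      using sin_int_2pin[of q] cos_int_2pin[of q] by (simp add: cos_add)
  qed
  finally have coeff: "(\<Sum>s\<in>dilate d X \<inter> {0..<p}. cos (2 * pi * real_of_int s / real_of_int p))
      * (real_of_int p - real_of_int Y.period_card) \<le> - (real_of_int Y.period_card)\<^sup>2"
    using \<xi>(2) nY P by (simp add: period_card_def)
  obtain a where a: "4 * real (card (dilate d X \<inter> {a..<a+m})) \<ge> real_of_int p + real_of_int p / 2000"
    using Y.dense_window_of_coefficient[OF big _ _ coeff] n nY by auto
  \<comment> \<open>Any \<open>e\<close> between \<open>3 * p / 20000\<close>, the permitted defect of the size, and \<open>p / 4000\<close>, half of the surplus in the window, would do, up to bounded terms.\<close>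
  define e where "e = p div 5000"
  have e: "e \<ge> 0" "5000 * e \<le> p" "p < 5000 * e + 5000" using big by (auto simp: e_def)
  have "dilate d X \<inter> {0..<p} \<subseteq> {Y.period_card..p - Y.period_card}"
  proof (rule Y.dense_window_imp_middle[OF _ e(1)])
    have "real_of_int p < 5000 * real_of_int e + 5000" using e(3) by linarith
    then have "real_of_int (p - e) \<le> real_of_int (3 * period_card)" using n(2) big by simp
    then show "p - e \<le> 3 * Y.period_card" unfolding nY of_int_le_iff .
    show "p + 2 * e + 20 \<le> 4 * int (card (dilate d X \<inter> {a..<a + m}))"
      using a e big by linarith
  qed
  then show ?thesis using d nY by auto
qed

end

section \<open>Counting dilates\<close>

locale sym_complete_sum_free = sym_sum_free +
  assumes complete: "z \<notin> X \<Longrightarrow> \<exists>x\<in>X. \<exists>y\<in>X. z = x + y"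

definition lifted_sets :: "int \<Rightarrow> int \<Rightarrow> int set set" where
  "lifted_sets p n = {X. sym_complete_sum_free p (p div 2) X \<and> int (card (X \<inter> {0..<p})) = n}"

definition middle_sets :: "int \<Rightarrow> int \<Rightarrow> int set set" where
  "middle_sets p n = {X \<in> lifted_sets p n. X \<inter> {0..<p} \<subseteq> {n..p - n}}"

lemma dilate_dilate: "dilate d (dilate e X) = dilate (e * d) X"
  by (simp add: dilate_def mult.assoc)

context sym_sum_free
begin

lemma dilate_cong:
  assumes "d mod p = e mod p"
  shows "dilate d X = dilate e X"
proof -
  have "(d * x) mod p = (e * x) mod p" for x using assms by (metis mod_mult_left_eq)
  then show ?thesis unfolding dilate_def using cong_iff by blast
qed

lemma dilate_uminus: "dilate (- d) X = dilate d X"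
  by (simp add: dilate_def sym_iff)

lemma dilate_one: "dilate 1 X = X" by (simp add: dilate_def)

end

lemma (in sym_complete_sum_free) complete_dilate:
  assumes de: "(d * e) mod p = 1"
  shows "sym_complete_sum_free p m (dilate d X)"
proof -
  interpret D: sym_sum_free p m "dilate d X" by (rule sym_sum_free_dilate)
  show ?thesis
  proof
    fix z assume "z \<notin> dilate d X"
    then have "d * z \<notin> X" by (simp add: dilate_def)
    then obtain x y where xy: "x \<in> X" "y \<in> X" "d * z = x + y" using complete by blast
    have "(e * d) mod p = 1" using de by (simp add: mult.commute)
    then have de': "(d * (e * s)) mod p = s mod p" "(e * (d * s)) mod p = s mod p" for s
      using de by (simp_all add: mult_inverse_mod)
    have "e * x \<in> dilate d X" using cong_iff[OF de'(1)[of x]] xy by (simp add: dilate_def)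
    moreover have "(z - e * x) mod p = (e * y) mod p"
    proof -
      have "(z - e * x) mod p = (e * (d * z) - e * x) mod p"
        using de'(2)[of z] by (metis mod_diff_left_eq)
      then show ?thesis using xy(3) by (simp add: algebra_simps)
    qed
    then have "z - e * x \<in> dilate d X"
      using D.cong_iff[of "z - e * x" "e * y"] cong_iff[OF de'(1)[of y]] xy by (simp add: dilate_def)
    ultimately show "\<exists>x\<in>dilate d X. \<exists>y\<in>dilate d X. z = x + y"
      by (intro bexI[of _ "e * x"] bexI[of _ "z - e * x"]) auto
  qed
qed

lemma lifted_sets_dilate:
  assumes "X \<in> lifted_sets p n" "(d * e) mod p = 1"
  shows "dilate d X \<in> lifted_sets p n"
proof -
  interpret sym_complete_sum_free p "p div 2" X using assms(1) by (simp add: lifted_sets_def)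
  show ?thesis
    using complete_dilate[OF assms(2)] bij_betw_same_card[OF bij_betw_dilate[OF assms(2)]] assms(1)
    by (simp add: lifted_sets_def)
qed

text \<open>
  If both \<open>X\<close> and \<open>Y = dilate d X\<close> fill the interval \<open>{n..p - n}\<close> up to \<open>2 * t\<close> residues, then a shift
  by a small \<open>k\<close> moves only about \<open>k\<close> elements out of \<open>Y\<close>. This number equals the number of elements that
  leave \<open>X\<close> under a shift by \<open>d * k\<close>, which is at least about \<open>min n (d * k)\<close> as long as \<open>d * k \<le> p / 2\<close>. For \<open>d \<ge> 2\<close> a
  multiple \<open>d * k\<close> in \<open>[p / 6, p / 2]\<close> with \<open>k \<le> p / 12 + 1\<close> is a contradiction.
\<close>

lemma middle_dilate_unique:
  assumes X: "X \<in> middle_sets p n" and Y: "dilate d X \<in> middle_sets p n"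
    and d: "1 \<le> d" "d \<le> p div 2"
    and p: "prime p" "p = 3 * n + 2 * t - 1" "1 \<le> t" "100 * t \<le> p" "p \<ge> 1000"
  shows "d = 1"
proof (rule ccontr)
  assume "d \<noteq> 1"
  then have d2: "d \<ge> 2" using d by simp
  interpret sym_complete_sum_free p "p div 2" X using X by (simp add: middle_sets_def lifted_sets_def)
  have cX: "int (card (X \<inter> {0..<p})) = n" "X \<inter> {0..<p} \<subseteq> {n..p - n}"
    using X by (auto simp: middle_sets_def lifted_sets_def)
  define Y where "Y = dilate d X"
  interpret Y: sym_complete_sum_free p "p div 2" Y
    using Y by (simp add: middle_sets_def lifted_sets_def Y_def)
  have cY: "int (card (Y \<inter> {0..<p})) = n" "Y \<inter> {0..<p} \<subseteq> {n..p - n}"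
    using Y by (auto simp: middle_sets_def lifted_sets_def Y_def)
  \<comment> \<open>The least \<open>k\<close> for which \<open>d * k\<close> exceeds \<open>p / 6\<close>.\<close>
  define k where "k = p div (6 * d) + 1"
  have k: "k \<ge> 1" "k \<le> p div 12 + 1"
    using zdiv_mono2[of p 12 "6 * d"] d2 p by (auto simp: k_def pos_imp_zdiv_nonneg_iff)
  have "6 * d * (p div (6 * d)) \<le> p" "p < 6 * d * (p div (6 * d)) + 6 * d"
    using d2 mult_div_mod_eq[of "6 * d" p] pos_mod_bound[of "6 * d" p] pos_mod_sign[of "6 * d" p]
    by linarith+
  then have dk: "p < 6 * (d * k)" "6 * (d * k) \<le> p + 6 * d" by (simp_all add: k_def algebra_simps)
  have dk_half: "2 * (d * k) \<le> p"
  proof (cases "3 * d \<le> p")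
    case True
    then show ?thesis using dk by linarith
  next
    case False
    then have "p div (6 * d) = 0" using p by (intro div_pos_pos_trivial) auto
    then show ?thesis using d by (simp add: k_def)
  qed
  have upper: "int (card {y \<in> Y \<inter> {0..<p}. y - k \<notin> Y}) \<le> k + 2 * t"
  proof -
    have "{y \<in> Y \<inter> {0..<p}. y - k \<notin> Y} \<subseteq> {n..n+k-1} \<union> (\<lambda>x. x + k) ` ({n..p-n} - Y)"
    proof
      fix y assume y: "y \<in> {y \<in> Y \<inter> {0..<p}. y - k \<notin> Y}"
      then have "n \<le> y" "y \<le> p - n" "y - k \<notin> Y" using cY(2) by auto
      then show "y \<in> {n..n+k-1} \<union> (\<lambda>x. x + k) ` ({n..p-n} - Y)"
        using k by (cases "y \<le> n + k - 1") (auto intro!: image_eqI[of _ _ "y - k"])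
    qed
    then have "card {y \<in> Y \<inter> {0..<p}. y - k \<notin> Y} \<le> card ({n..n+k-1} \<union> (\<lambda>x. x + k) ` ({n..p-n} - Y))"
      by (intro card_mono) auto
    also have "\<dots> \<le> card {n..n+k-1} + card ({n..p-n} - Y)"
      by (intro order.trans[OF card_Un_le] add_mono card_image_le) auto
    finally have "int (card {y \<in> Y \<inter> {0..<p}. y - k \<notin> Y}) \<le> k + int (card ({n..p-n} - Y))"
      using k by simp
    moreover have "{n..p-n} - Y = {n..p-n} - (Y \<inter> {0..<p})" using p by auto
    then have "int (card ({n..p-n} - Y)) = int (card {n..p-n}) - n"
      using card_Diff_subset[of "Y \<inter> {0..<p}" "{n..p-n}"] cY card_mono[OF _ cY(2)] by (simp add: of_nat_diff)
    ultimately show ?thesis using p by simp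
  qed
  have same: "card {y \<in> Y \<inter> {0..<p}. y - k \<notin> Y} = card {x \<in> X \<inter> {0..<p}. x - d * k \<notin> X}"
  proof -
    have "\<not> p dvd d" using d p by (intro zdvd_not_zless) auto
    then obtain e where de: "(d * e) mod p = 1" using prime_inverse_mod[OF p(1)] by blast
    let ?f = "\<lambda>s. (e * s) mod p"
    have bij: "bij_betw ?f (X \<inter> {0..<p}) (Y \<inter> {0..<p})"
      unfolding Y_def by (rule bij_betw_dilate[OF de])
    have iff: "?f x - k \<notin> Y \<longleftrightarrow> x - d * k \<notin> X" for x
    proof -
      have "(d * ?f x) mod p = x mod p" using mult_inverse_mod[OF de] by (simp add: mod_mult_right_eq)
      then have "(d * ?f x - d * k) mod p = (x - d * k) mod p" by (rule mod_diff_cong) simp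
      then have "d * ?f x - d * k \<in> X \<longleftrightarrow> x - d * k \<in> X" by (rule cong_iff)
      then show ?thesis by (simp add: Y_def dilate_def right_diff_distrib)
    qed
    have "{y \<in> Y \<inter> {0..<p}. y - k \<notin> Y} = ?f ` {x \<in> X \<inter> {0..<p}. x - d * k \<notin> X}"
      unfolding bij_betw_imp_surj_on[OF bij, symmetric] using iff by auto
    moreover have "inj_on ?f {x \<in> X \<inter> {0..<p}. x - d * k \<notin> X}"
      using bij_betw_imp_inj_on[OF bij] by (rule inj_on_subset) auto
    ultimately show ?thesis by (simp add: card_image)
  qed
  have lower: "int (card {x \<in> X \<inter> {0..<p}. x - d * k \<notin> X}) \<ge> min n (d * k - 2 * t)"
  proof -
    have "X \<inter> {0..<p} \<subseteq> {x \<in> X \<inter> {0..<p}. x - d * k \<notin> X} \<union> {n + d * k..p - n}"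
    proof
      fix x assume x: "x \<in> X \<inter> {0..<p}"
      then have xr: "n \<le> x" "x \<le> p - n" using cX by auto
      have "x - d * k \<notin> X" if "x < n + d * k"
      proof
        assume in_X: "x - d * k \<in> X"
        show False
        proof (cases "x - d * k \<ge> 0")
          case True
          then have "n \<le> x - d * k" using in_X cX xr dk p by auto
          then show False using that by simp
        next
          case False
          then have "x - d * k + p \<in> X \<inter> {0..<p}"
            using in_X periodic[of "x - d * k" 1] dk_half xr p by auto
          then have "x - d * k + p \<le> p - n" using cX by auto
          then show False using xr dk_half p by simp
        qed
      qed
      then show "x \<in> {x \<in> X \<inter> {0..<p}. x - d * k \<notin> X} \<union> {n + d * k..p - n}"
        using x xr by (cases "x < n + d * k") auto
    qed
    moreover have "finite {x \<in> X \<inter> {0..<p}. x - d * k \<notin> X}"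
      by (rule finite_subset[of _ "X \<inter> {0..<p}"]) auto
    ultimately have "card (X \<inter> {0..<p})
        \<le> card ({x \<in> X \<inter> {0..<p}. x - d * k \<notin> X} \<union> {n + d * k..p - n})"
      by (intro card_mono finite_UnI finite_atLeastAtMost_int)
    also have "\<dots> \<le> card {x \<in> X \<inter> {0..<p}. x - d * k \<notin> X} + card {n + d * k..p - n}" by (rule card_Un_le)
    finally have "n \<le> int (card {x \<in> X \<inter> {0..<p}. x - d * k \<notin> X}) + max 0 (p - n - (n + d * k) + 1)"
      using cX by simp
    then show ?thesis using p by (auto simp: max_def min_def split: if_splits)
  qed
  show False using upper lower same k dk p by (auto simp: min_def split: if_splits)
qed

text \<open>
  Every set is a dilate of one in the middle, and the dilation factor is unique up to sign. So the
  pairs of a factor in \<open>{1..p div 2}\<close> and a middle set parametrise all sets.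
\<close>

lemma card_lifted_sets:
  assumes p: "prime p" "p = 3 * n + 2 * t - 1" "1 \<le> t" "100 * t \<le> p" "p \<ge> 1000"
    and middle: "\<And>X. X \<in> lifted_sets p n \<Longrightarrow> \<exists>d\<in>{1..<p}. dilate d X \<in> middle_sets p n"
  shows "card (lifted_sets p n) = nat (p div 2) * card (middle_sets p n)"
proof -
  define m where "m = p div 2"
  have p_odd: "p = 2 * m + 1"
    using prime_odd_int[OF p(1)] p(5) by (auto simp: m_def elim: oddE)
  have inv: "\<exists>e\<in>{1..<p}. (d * e) mod p = 1" if "\<not> p dvd d" for d
    using prime_inverse_mod[OF p(1) that] .
  have small_rep: "\<exists>f\<in>{1..m}. f mod p = d mod p \<or> f mod p = (- d) mod p" if "\<not> p dvd d" for d
  proof -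
    have r: "d mod p \<noteq> 0" "0 \<le> d mod p" "d mod p < p" using that p by auto
    show ?thesis
    proof (cases "d mod p \<le> m")
      case True
      then show ?thesis using r by (intro bexI[of _ "d mod p"]) auto
    next
      case False
      have "(p - d mod p) mod p = (- d) mod p"
        by (metis minus_mod_self1 mod_minus_eq uminus_add_conv_diff add.commute diff_add_cancel mod_add_self2)
      then show ?thesis using r False p_odd by (intro bexI[of _ "p - d mod p"]) auto
    qed
  qed
  have not_dvd: "\<not> p dvd d" if "1 \<le> d" "d < p" for d
    using that by (intro zdvd_not_zless) auto
  have "bij_betw (\<lambda>(d, Y). dilate d Y) ({1..m} \<times> middle_sets p n) (lifted_sets p n)"
    unfolding bij_betw_def
  proof
    show "inj_on (\<lambda>(d, Y). dilate d Y) ({1..m} \<times> middle_sets p n)"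
    proof (rule inj_onI, clarify)
      fix d Y d' Y'
      assume d: "d \<in> {1..m}" and Y: "Y \<in> middle_sets p n" and d': "d' \<in> {1..m}"
        and Y': "Y' \<in> middle_sets p n" and eq: "dilate d Y = dilate d' Y'"
      interpret Y: sym_complete_sum_free p "p div 2" Y using Y by (simp add: middle_sets_def lifted_sets_def)
      interpret Y': sym_complete_sum_free p "p div 2" Y' using Y' by (simp add: middle_sets_def lifted_sets_def)
      obtain e where e: "(d' * e) mod p = 1" using inv not_dvd[of d'] d' p_odd by auto
      have "Y' = dilate e (dilate d' Y')"
        using Y'.dilate_cong[of "d' * e" 1] e p(5) Y'.dilate_one by (simp add: dilate_dilate)
      then have Y'_eq: "Y' = dilate (d * e) Y" using eq by (metis dilate_dilate)
      have "\<not> p dvd d * e"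
      proof
        assume "p dvd d * e"
        moreover have "\<not> p dvd d" using not_dvd[of d] d p_odd by auto
        ultimately have "p dvd e" using p(1) by (simp add: prime_dvd_mult_iff)
        then show False using e by (auto simp: dvd_def)
      qed
      then obtain f where f: "f \<in> {1..m}" "f mod p = (d * e) mod p \<or> f mod p = (- (d * e)) mod p"
        using small_rep by blast
      then have "dilate f Y = Y'"
        using Y.dilate_cong[of f "d * e"] Y.dilate_cong[of f "- (d * e)"] Y.dilate_uminus Y'_eq by metis
      then have "f = 1" using middle_dilate_unique[OF Y, of f t] Y' f(1) p by (auto simp: m_def)
      then have "(d * e) mod p = 1 mod p \<or> (- (d * e)) mod p = 1 mod p" using f(2) by auto
      have "d = d'"
      proof -
        have de: "(d' * (d * e)) mod p = d mod p"
          using mult_inverse_mod[OF e, of d] by (simp add: mult_ac)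
        from \<open>(d * e) mod p = 1 mod p \<or> (- (d * e)) mod p = 1 mod p\<close>
        have "d mod p = d' mod p \<or> d mod p = (- d') mod p"
        proof
          assume "(d * e) mod p = 1 mod p"
          then have "(d' * (d * e)) mod p = (d' * 1) mod p" by (metis mod_mult_right_eq)
          then show ?thesis using de by simp
        next
          assume "(- (d * e)) mod p = 1 mod p"
          then have "(- d' * (- (d * e))) mod p = (- d' * 1) mod p" by (metis mod_mult_right_eq)
          then show ?thesis using de by simp
        qed
        then show ?thesis
        proof
          assume "d mod p = d' mod p"
          then show ?thesis using d d' p_odd by simp
        next
          assume "d mod p = (- d') mod p"
          then have "p dvd d + d'" by (simp add: mod_eq_dvd_iff)
          then show ?thesis using not_dvd[of "d + d'"] d d' p_odd by auto
        qed
      qed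
      moreover have "Y' = Y" using \<open>dilate f Y = Y'\<close> \<open>f = 1\<close> Y.dilate_one by simp
      ultimately show "d = d' \<and> Y = Y'" by simp
    qed
    show "(\<lambda>(d, Y). dilate d Y) ` ({1..m} \<times> middle_sets p n) = lifted_sets p n"
    proof (intro equalityI subsetI)
      fix X assume "X \<in> (\<lambda>(d, Y). dilate d Y) ` ({1..m} \<times> middle_sets p n)"
      then obtain d Y where d: "d \<in> {1..m}" and Y: "Y \<in> middle_sets p n" and X: "X = dilate d Y" by auto
      obtain e where "(d * e) mod p = 1" using inv not_dvd[of d] d p_odd by auto
      then show "X \<in> lifted_sets p n" using lifted_sets_dilate Y X by (simp add: middle_sets_def)
    next
      fix X assume X: "X \<in> lifted_sets p n"
      interpret sym_complete_sum_free p "p div 2" X using X by (simp add: lifted_sets_def)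
      obtain d where d: "d \<in> {1..<p}" "dilate d X \<in> middle_sets p n" using middle[OF X] by blast
      have "\<not> p dvd d" using not_dvd[of d] d by simp
      then obtain e where e: "e \<in> {1..<p}" "(d * e) mod p = 1" using inv by blast
      obtain f where f: "f \<in> {1..m}" "f mod p = e mod p \<or> f mod p = (- e) mod p"
        using small_rep[of e] not_dvd[of e] e by auto
      have "dilate f (dilate d X) = X"
        using f(2)
      proof
        assume "f mod p = e mod p"
        then have "(d * f) mod p = 1 mod p" using e p(5) by (metis mod_mult_right_eq mod_pos_pos_trivial mod_mod_trivial)
        then show ?thesis using dilate_cong[of "d * f" 1] dilate_one by (simp add: dilate_dilate)
      next
        assume "f mod p = (- e) mod p"
        then have "(d * f) mod p = (d * - e) mod p" by (metis mod_mult_right_eq)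
        also have "\<dots> = (- 1) mod p" using e(2) by (metis mod_minus_eq mult_minus_right)
        finally have "dilate (d * f) X = dilate (- 1) X" by (rule dilate_cong)
        then show ?thesis using dilate_uminus[of 1] dilate_one by (simp add: dilate_dilate)
      qed
      then show "X \<in> (\<lambda>(d, Y). dilate d Y) ` ({1..m} \<times> middle_sets p n)"
        using f(1) d(2) by (force intro!: image_eqI[of _ _ "(f, dilate d X)"])
    qed
  qed
  then have "card (lifted_sets p n) = card ({1..m} \<times> middle_sets p n)" by (rule bij_betw_same_card[symmetric])
  then show ?thesis by (simp add: card_cartesian_product m_def)
qed

section \<open>Sets in the middle third and special sets\<close>

text \<open>
  For \<open>p = 3 * n + 2 * t - 1\<close> the interval \<open>{n..p - n}\<close> has \<open>n + 2 * t\<close> elements. A set of the middle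
  consists of a copy of \<open>T\<close> at its left end, the mirror image at its right end, and everything in
  between.
\<close>

definition residues_of :: "int \<Rightarrow> int \<Rightarrow> int set \<Rightarrow> int set" where
  "residues_of n t T = (\<lambda>x. n + x) ` T \<union> {n + 2 * t..2 * n - 1} \<union> (\<lambda>x. 2 * n + 2 * t - 1 - x) ` T"

definition left_edge :: "int \<Rightarrow> int \<Rightarrow> int set \<Rightarrow> int set" where
  "left_edge n t X = {x \<in> {0..2 * t - 1}. n + x \<in> X}"

definition lift :: "int \<Rightarrow> int set \<Rightarrow> int set" where
  "lift p S = {z. z mod p \<in> S}"

lemma card_residues_of:
  assumes "T \<subseteq> {0..2 * t - 1}" "2 * t \<le> n"
  shows "int (card (residues_of n t T)) = 2 * int (card T) + (n - 2 * t)"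
proof -
  have fin: "finite T" using assms(1) finite_subset by blast
  let ?A = "(\<lambda>x. n + x) ` T" and ?B = "{n + 2 * t..2 * n - 1}" and ?C = "(\<lambda>x. 2 * n + 2 * t - 1 - x) ` T"
  have "?A \<subseteq> {..n + 2 * t - 1}" "?C \<subseteq> {2 * n..}" using assms by auto
  then have "?A \<inter> ?B = {}" "(?A \<union> ?B) \<inter> ?C = {}" using assms(2) by fastforce+
  then have "card (residues_of n t T) = card ?A + card ?B + card ?C"
    unfolding residues_of_def using fin by (simp add: card_Un_disjoint)
  also have "card ((\<lambda>x. n + x) ` T) = card T" by (simp add: card_image)
  also have "card ((\<lambda>x. 2 * n + 2 * t - 1 - x) ` T) = card T" by (simp add: card_image inj_on_def)
  finally show ?thesis using assms(2) by simp
qed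

text \<open>
  A sum of two representatives in \<open>{0..<p}\<close> wraps around at most once.
\<close>

lemma (in sym_complete_sum_free) complete_window:
  assumes "z \<notin> X" "0 \<le> z" "z < p"
  shows "\<exists>x\<in>X \<inter> {0..<p}. \<exists>y\<in>X \<inter> {0..<p}. x + y = z \<or> x + y = z + p"
proof -
  obtain x y where xy: "x \<in> X" "y \<in> X" "z = x + y" using complete assms(1) by blast
  have r: "x mod p \<in> X \<inter> {0..<p}" "y mod p \<in> X \<inter> {0..<p}" using xy p_pos by (auto simp: mod_iff)
  have "x mod p + y mod p = z - (x div p + y div p) * p"
    using mod_div_mult_eq[of x p] mod_div_mult_eq[of y p] xy(3) by (simp add: algebra_simps)
  then have zq: "z = x mod p + y mod p + (x div p + y div p) * p" by simp
  then obtain q where q: "z = x mod p + y mod p + q * p" by blast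
  have "0 \<le> x mod p" "x mod p < p" "0 \<le> y mod p" "y mod p < p" using p_pos by auto
  then have "(- 2) * p < q * p" "q * p < 1 * p" using q assms by linarith+
  then have "q = 0 \<or> q = - 1" using p_pos unfolding mult_less_cancel_right by auto
  then have "x mod p + y mod p = z \<or> x mod p + y mod p = z + p" using q by auto
  then show ?thesis using r by blast
qed

text \<open>
  The residues \<open>n + 2 * t, \<dots>, 2 * n - 1\<close> are not sums of two elements of \<open>{n..p - n}\<close>, so completeness puts
  them into \<open>X\<close>; the size of \<open>X\<close> then leaves \<open>t\<close> elements for each end. A solution of \<open>x + y + z = 2 * t - 1\<close>
  in the left end is a sum of two elements there that is an element of the right end. Condition (iii)
  for \<open>y\<close> is completeness at \<open>2 * n + y\<close>: such a number is so small that it can only be a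
  sum of two elements of the left end.
\<close>

lemma left_edge_special:
  assumes X: "X \<in> middle_sets p n" and p: "p = 3 * n + 2 * t - 1" "1 \<le> t" "4 * t \<le> n"
  shows "special t (left_edge n t X)" and "X \<inter> {0..<p} = residues_of n t (left_edge n t X)"
proof -
  interpret sym_complete_sum_free p "p div 2" X using X by (simp add: middle_sets_def lifted_sets_def)
  have cX: "int (card (X \<inter> {0..<p})) = n" "X \<inter> {0..<p} \<subseteq> {n..p - n}"
    using X by (auto simp: middle_sets_def lifted_sets_def)
  define T where "T = left_edge n t X"
  have Tsub: "T \<subseteq> {0..2 * t - 1}" by (auto simp: T_def left_edge_def)
  have T_iff: "x \<in> T \<longleftrightarrow> 0 \<le> x \<and> x \<le> 2 * t - 1 \<and> n + x \<in> X" for x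
    by (auto simp: T_def left_edge_def)
  have block: "z \<in> X" if "z \<in> {n + 2 * t..2 * n - 1}" for z
  proof (rule ccontr)
    assume "z \<notin> X"
    moreover have zr: "0 \<le> z" "z < p" using that p by auto
    ultimately obtain x y where xy: "x \<in> X \<inter> {0..<p}" "y \<in> X \<inter> {0..<p}" "x + y = z \<or> x + y = z + p"
      using complete_window[of z] zr by blast
    then have "n \<le> x" "x \<le> p - n" "n \<le> y" "y \<le> p - n" using cX(2) by auto
    then show False using xy(3) that p by auto
  qed
  show XT: "X \<inter> {0..<p} = residues_of n t T"
  proof (intro equalityI subsetI)
    fix s assume s: "s \<in> X \<inter> {0..<p}"
    then have sr: "n \<le> s" "s \<le> p - n" using cX(2) by auto
    consider "s \<le> n + 2 * t - 1" | "n + 2 * t \<le> s" "s \<le> 2 * n - 1" | "2 * n \<le> s" by linarith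
    then show "s \<in> residues_of n t T"
    proof cases
      case 1
      then have "s - n \<in> T" using s sr by (simp add: T_iff)
      then show ?thesis unfolding residues_of_def by force
    next
      case 2
      then show ?thesis by (simp add: residues_of_def)
    next
      case 3
      have "p - s \<in> X" using s by (simp add: reflect)
      moreover have "n + (2 * n + 2 * t - 1 - s) = p - s" using p by simp
      ultimately have "n + (2 * n + 2 * t - 1 - s) \<in> X" by (simp only:)
      moreover have "0 \<le> 2 * n + 2 * t - 1 - s" "2 * n + 2 * t - 1 - s \<le> 2 * t - 1" using 3 sr p by auto
      ultimately have "2 * n + 2 * t - 1 - s \<in> T" unfolding T_iff by blast
      then show ?thesis unfolding residues_of_def by force
    qed
  next
    fix s assume "s \<in> residues_of n t T"
    then consider x where "x \<in> T" "s = n + x" | "s \<in> {n + 2 * t..2 * n - 1}"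
      | x where "x \<in> T" "s = 2 * n + 2 * t - 1 - x" unfolding residues_of_def by blast
    then show "s \<in> X \<inter> {0..<p}"
    proof cases
      case 1
      then show ?thesis using p by (auto simp: T_iff)
    next
      case 2
      then show ?thesis using block p by auto
    next
      case 3
      then have "s = p - (n + x)" using p by simp
      then have "s \<in> X" using 3(1) reflect[of "n + x"] by (simp add: T_iff)
      then show ?thesis using 3 p by (auto simp: T_iff)
    qed
  qed
  have cT: "int (card T) = t" using card_residues_of[OF Tsub, of n] XT cX(1) p by simp
  then have T_ne: "T \<noteq> {}" "finite T" using p(2) Tsub finite_subset[OF Tsub] by auto
  have "2 * t - 1 \<notin> T + T + T"
  proof
    assume "2 * t - 1 \<in> T + T + T"
    then obtain x y z where xyz: "x \<in> T" "y \<in> T" "z \<in> T" "2 * t - 1 = x + y + z"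
      by (auto elim!: set_plus_elim)
    then have "(n + x) + (n + y) = p - (n + z)" using p by simp
    moreover have "p - (n + z) \<in> X" using xyz(3) unfolding reflect T_iff by blast
    moreover have "(n + x) + (n + y) \<notin> X" using xyz(1,2) sum_free unfolding T_iff by blast
    ultimately show False by metis
  qed
  moreover have "{0..2 * t - 1 + Min T} - (\<lambda>x. 2 * t - 1 - x) ` T \<subseteq> T + T"
  proof
    fix y assume y: "y \<in> {0..2 * t - 1 + Min T} - (\<lambda>x. 2 * t - 1 - x) ` T"
    have MinT: "Min T \<in> T" "\<And>x. x \<in> T \<Longrightarrow> Min T \<le> x" using T_ne by auto
    have Mr: "0 \<le> Min T" "Min T \<le> 2 * t - 1" using MinT(1) by (auto simp: T_iff)
    have zr: "0 \<le> 2 * n + y" "2 * n + y < p" using y Mr p by auto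
    have "2 * n + y \<notin> X"
    proof
      assume "2 * n + y \<in> X"
      then have "2 * n + y \<in> X \<inter> {0..<p}" using zr by simp
      then consider x where "x \<in> T" "2 * n + y = n + x" | "2 * n + y \<in> {n + 2 * t..2 * n - 1}"
        | x where "x \<in> T" "2 * n + y = 2 * n + 2 * t - 1 - x"
        unfolding XT residues_of_def by blast
      then show False
      proof cases
        case 1
        then show False using y p by (auto simp: T_iff)
      next
        case 2
        then show False using y by simp
      next
        case 3
        then have "y = 2 * t - 1 - x" by simp
        then show False using y 3(1) by blast
      qed
    qed
    then obtain a b where ab: "a \<in> X \<inter> {0..<p}" "b \<in> X \<inter> {0..<p}"
      "a + b = 2 * n + y \<or> a + b = 2 * n + y + p"
      using complete_window zr by blast
    have low: "n + Min T \<le> s \<and> s \<le> p - n" if "s \<in> X \<inter> {0..<p}" for s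
    proof -
      have "s \<in> residues_of n t T" using that XT by simp
      then have "n + Min T \<le> s" using MinT(2) Mr p Tsub unfolding residues_of_def by force
      then show ?thesis using that cX(2) by auto
    qed
    have sum: "a + b = 2 * n + y" using ab(3) low[OF ab(1)] low[OF ab(2)] y p by auto
    then have "a \<le> n + 2 * t - 1" "b \<le> n + 2 * t - 1" using low[OF ab(1)] low[OF ab(2)] y by auto
    then have "a - n \<in> T" "b - n \<in> T" using ab low[OF ab(1)] low[OF ab(2)] Mr by (auto simp: T_iff)
    then have "(a - n) + (b - n) \<in> T + T" by blast
    then show "y \<in> T + T" using sum by (simp add: algebra_simps)
  qed
  ultimately show "special t T" using Tsub cT by (simp add: special_def)
qed

text \<open>
  Conversely, by the symmetry \<open>z \<mapsto> p - z\<close> only sums in \<open>{2 * n..p}\<close> matter. Those that fall into the set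
  are sums of two elements of the left end, excluded by condition (ii). To reach every \<open>z\<close> outside the
  set, condition (iii) serves the numbers up to \<open>p - n + Min T\<close>, the sum of \<open>n + Min T\<close> and the middle
  block the next \<open>n - 2 * t\<close>, and the sum of the block with itself the rest.
\<close>

lemma lift_special:
  assumes T: "special t T" and p: "p = 3 * n + 2 * t - 1" "1 \<le> t" "4 * t \<le> n" "odd p"
  shows "lift p (residues_of n t T) \<in> middle_sets p n"
    and "left_edge n t (lift p (residues_of n t T)) = T"
proof -
  define C where "C = residues_of n t T"
  define X where "X = lift p C"
  have Tsub: "T \<subseteq> {0..2 * t - 1}" and cT: "int (card T) = t" and T3: "2 * t - 1 \<notin> T + T + T"
    and T2: "{0..2 * t - 1 + Min T} - (\<lambda>x. 2 * t - 1 - x) ` T \<subseteq> T + T"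
    using T by (auto simp: special_def)
  have Tr: "0 \<le> x \<and> x \<le> 2 * t - 1" if "x \<in> T" for x using Tsub that by auto
  have T_ne: "T \<noteq> {}" "finite T" using cT p(2) finite_subset[OF Tsub] by auto
  have Cr: "n \<le> s \<and> s \<le> p - n \<and> 0 < s \<and> s < p" if "s \<in> C" for s
    using that p Tr unfolding C_def residues_of_def by force
  have C_left: "s - n \<in> T" if "s \<in> C" "s \<le> n + 2 * t - 1" for s
    using that p Tr unfolding C_def residues_of_def by force
  have C_right: "2 * n + 2 * t - 1 - s \<in> T" if "s \<in> C" "2 * n \<le> s" for s
    using that p Tr unfolding C_def residues_of_def by force
  have C_refl: "p - s \<in> C" if "s \<in> C" for s
  proof -
    from that consider x where "x \<in> T" "s = n + x" | "s \<in> {n + 2 * t..2 * n - 1}"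
      | x where "x \<in> T" "s = 2 * n + 2 * t - 1 - x" unfolding C_def residues_of_def by blast
    then show ?thesis
    proof cases
      case 1
      then have "p - s = 2 * n + 2 * t - 1 - x" using p by simp
      then show ?thesis using 1 unfolding C_def residues_of_def by blast
    next
      case 2
      then have "p - s \<in> {n + 2 * t..2 * n - 1}" using p by auto
      then show ?thesis unfolding C_def residues_of_def by blast
    next
      case 3
      then have "p - s = n + x" using p by simp
      then show ?thesis using 3 unfolding C_def residues_of_def by blast
    qed
  qed
  have free: "a + b \<notin> C" if ab: "a \<in> C" "b \<in> C" for a b
  proof
    assume s: "a + b \<in> C"
    have "a - n \<in> T" "b - n \<in> T" using C_left[of a] C_left[of b] Cr[OF s] Cr[OF ab(1)] Cr[OF ab(2)] ab p by auto
    moreover have "2 * n + 2 * t - 1 - (a + b) \<in> T" using C_right[OF s] Cr[OF ab(1)] Cr[OF ab(2)] by auto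
    ultimately have "(a - n) + (b - n) + (2 * n + 2 * t - 1 - (a + b)) \<in> T + T + T" by blast
    then show False using T3 by simp
  qed
  have reach: "\<exists>a\<in>C. \<exists>b\<in>C. a + b = z" if z: "2 * n \<le> z" "z \<le> p" "z \<notin> C" for z
  proof -
    have MinT: "Min T \<in> T" using T_ne by auto
    have nM: "n + Min T \<in> C" using MinT by (auto simp: C_def residues_of_def)
    have blk: "s \<in> C" if "n + 2 * t \<le> s" "s \<le> 2 * n - 1" for s
      using that by (simp add: C_def residues_of_def)
    consider "z - 2 * n \<le> 2 * t - 1 + Min T" | "2 * n + 2 * t + Min T \<le> z" "z \<le> 3 * n - 1 + Min T"
      | "3 * n + Min T \<le> z" by linarith
    then show ?thesis
    proof cases
      case 1
      have "z - 2 * n \<notin> (\<lambda>x. 2 * t - 1 - x) ` T"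
      proof
        assume "z - 2 * n \<in> (\<lambda>x. 2 * t - 1 - x) ` T"
        then obtain x where "x \<in> T" "z = 2 * n + 2 * t - 1 - x" by auto
        then show False using z(3) by (auto simp: C_def residues_of_def)
      qed
      then have "z - 2 * n \<in> T + T" using T2 1 z(1) by auto
      then obtain x y where "x \<in> T" "y \<in> T" "z - 2 * n = x + y" by (auto elim!: set_plus_elim)
      then show ?thesis
        by (intro bexI[of _ "n + x"] bexI[of _ "n + y"]) (auto simp: C_def residues_of_def)
    next
      case 2
      then have "z - n - Min T \<in> C" by (intro blk) auto
      then show ?thesis using nM by (intro bexI[of _ "n + Min T"] bexI[of _ "z - n - Min T"]) auto
    next
      case 3
      have "n + 2 * t \<in> C" "z - n - 2 * t \<in> C"
        using 3 z p Tr[OF MinT] by (auto intro!: blk)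
      then show ?thesis by (intro bexI[of _ "n + 2 * t"] bexI[of _ "z - n - 2 * t"]) auto
    qed
  qed
  have X_iff: "x \<in> X \<longleftrightarrow> x mod p \<in> C" for x by (simp add: X_def lift_def)
  have p0: "p > 0" using p by simp
  have XC: "X \<inter> {0..<p} = C"
  proof (intro equalityI subsetI)
    fix x assume "x \<in> C"
    then show "x \<in> X \<inter> {0..<p}" using Cr[of x] by (simp add: X_iff)
  next
    fix x assume x: "x \<in> X \<inter> {0..<p}"
    then have "x mod p = x" by simp
    then show "x \<in> C" using x X_iff[of x] by simp
  qed
  have "sym_complete_sum_free p (p div 2) X"
  proof
    show "p = 2 * (p div 2) + 1" using p(4) by simp
    show "1 \<le> p div 2" using p by auto
    show "x + j * p \<in> X" if "x \<in> X" for x j using that by (simp add: X_iff)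
    show "- x \<in> X" if "x \<in> X" for x
    proof -
      have in_C: "p - x mod p \<in> C" using that C_refl by (simp add: X_iff)
      have "(- x) mod p = (p - x mod p) mod p" by (simp add: mod_minus_eq)
      also have "\<dots> = p - x mod p" using Cr[OF in_C] by (intro mod_pos_pos_trivial) auto
      finally show ?thesis using in_C unfolding X_iff by (simp only:)
    qed
    show "x + y \<notin> X" if xy: "x \<in> X" "y \<in> X" for x y
    proof
      assume "x + y \<in> X"
      define a b where "a = x mod p" and "b = y mod p"
      have ab: "a \<in> C" "b \<in> C" "(a + b) mod p \<in> C"
        using xy \<open>x + y \<in> X\<close> by (auto simp: X_iff a_def b_def mod_add_eq)
      show False
      proof (cases "a + b < p")
        case True
        then have "(a + b) mod p = a + b" using Cr[OF ab(1)] Cr[OF ab(2)] by simp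
        then show False using free[OF ab(1,2)] ab(3) by simp
      next
        case False
        have "(a + b) mod p = (a + b - p) mod p" by simp
        also have "\<dots> = a + b - p" using False Cr[OF ab(1)] Cr[OF ab(2)] by (intro mod_pos_pos_trivial) auto
        finally have "p - (a + b - p) \<in> C" using ab(3) C_refl by metis
        then have "(p - a) + (p - b) \<in> C" by (simp add: algebra_simps)
        then show False using free C_refl ab by blast
      qed
    qed
    show "\<exists>x\<in>X. \<exists>y\<in>X. z = x + y" if "z \<notin> X" for z
    proof -
      define w where "w = z mod p"
      have w: "w \<notin> C" "0 \<le> w" "w < p" using that p0 by (auto simp: w_def X_iff)
      have "\<exists>a\<in>C. \<exists>b\<in>C. (a + b) mod p = w"
      proof (cases "2 * n \<le> w")
        case True
        then obtain a b where ab: "a \<in> C" "b \<in> C" "a + b = w" using reach[of w] w by (meson less_imp_le)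
        then have "(a + b) mod p = w" using w by simp
        then show ?thesis using ab by blast
      next
        case False
        have notin: "p - w \<notin> C" using C_refl[of "p - w"] w(1) by auto
        moreover have "n + 2 * t \<le> p - w" using False p by simp
        moreover have "s \<in> C" if "n + 2 * t \<le> s" "s \<le> 2 * n - 1" for s
          using that by (simp add: C_def residues_of_def)
        ultimately have "2 * n \<le> p - w" by force
        moreover have "p - w \<le> p" using w by simp
        ultimately obtain a b where ab: "a \<in> C" "b \<in> C" "a + b = p - w"
          using reach notin by blast
        have "(p - a) + (p - b) = w + p" using ab(3) by simp
        moreover have "(w + p) mod p = w" using w by simp
        ultimately have "((p - a) + (p - b)) mod p = w" by (simp only:)
        then show ?thesis using C_refl ab by blast
      qed
      then obtain a b where ab: "a \<in> C" "b \<in> C" "(a + b) mod p = z mod p" by (auto simp: w_def)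
      have "(z - a) mod p = (a + b - a) mod p" using ab(3) by (metis mod_diff_left_eq)
      then have "(z - a) mod p = b" using Cr[OF ab(2)] by simp
      then have "z - a \<in> X" "a \<in> X" using ab Cr[OF ab(1)] by (auto simp: X_iff)
      then show ?thesis by (intro bexI[of _ a] bexI[of _ "z - a"]) auto
    qed
  qed
  moreover have "int (card C) = n" using card_residues_of[OF Tsub, of n] cT p by (simp add: C_def)
  moreover have "C \<subseteq> {n..p - n}" using Cr by auto
  ultimately show "X \<in> middle_sets p n" by (simp add: middle_sets_def lifted_sets_def XC)
  show "left_edge n t X = T"
  proof (intro equalityI subsetI)
    fix x assume "x \<in> left_edge n t X"
    then have x: "0 \<le> x" "x \<le> 2 * t - 1" "n + x \<in> X" by (auto simp: left_edge_def)
    then have "n + x \<in> C" using XC p by auto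
    then show "x \<in> T" using C_left[of "n + x"] x by simp
  next
    fix x assume x: "x \<in> T"
    then have "n + x \<in> C" by (simp add: C_def residues_of_def)
    then show "x \<in> left_edge n t X" using Tr[OF x] XC by (auto simp: left_edge_def)
  qed
qed

lemma card_middle_sets:
  assumes p: "p = 3 * n + 2 * t - 1" "1 \<le> t" "4 * t \<le> n" "odd p"
  shows "card (middle_sets p n) = g t"
proof -
  have "bij_betw (left_edge n t) (middle_sets p n) {T. special t T}"
  proof (rule bij_betwI[where g = "\<lambda>T. lift p (residues_of n t T)"])
    show "left_edge n t \<in> middle_sets p n \<rightarrow> {T. special t T}"
      using left_edge_special(1)[OF _ p(1-3)] by auto
    show "(\<lambda>T. lift p (residues_of n t T)) \<in> {T. special t T} \<rightarrow> middle_sets p n"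
      using lift_special(1)[OF _ p] by auto
    show "left_edge n t (lift p (residues_of n t T)) = T" if "T \<in> {T. special t T}" for T
      using lift_special(2)[OF _ p] that by auto
    show "lift p (residues_of n t (left_edge n t X)) = X" if X: "X \<in> middle_sets p n" for X
    proof -
      interpret sym_complete_sum_free p "p div 2" X using X by (simp add: middle_sets_def lifted_sets_def)
      show ?thesis
        unfolding left_edge_special(2)[OF X p(1-3), symmetric] lift_def using p_pos by (auto simp: mod_iff)
    qed
  qed
  then show ?thesis unfolding g_def by (rule bij_betw_same_card)
qed

section \<open>Residue rings and the count\<close>

lemma symmetric_complete_sum_free_sets_iff:
  assumes "p > 1"
  shows "S \<in> symmetric_complete_sum_free_sets (residue_ring p) \<longleftrightarrow>
    S \<subseteq> {0..<p} \<and> S = (\<lambda>x. (- x) mod p) ` S \<and>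
    (\<forall>z\<in>{0..<p} - S. \<exists>x\<in>S. \<exists>y\<in>S. z = (x + y) mod p) \<and>
    (\<forall>x\<in>S. \<forall>y\<in>S. (x + y) mod p \<notin> S)"
proof -
  interpret residues p "residue_ring p" using assms by unfold_locales simp_all
  have carrier: "carrier (residue_ring p) = {0..<p}" by (auto simp: res_carrier_eq)
  have neg: "a_set_inv\<^bsub>residue_ring p\<^esub> S = (\<lambda>x. (- x) mod p) ` S"
    by (auto simp: A_SET_INV_def' res_neg_eq)
  have plus: "S <+>\<^bsub>residue_ring p\<^esub> S = {z. \<exists>x\<in>S. \<exists>y\<in>S. z = (x + y) mod p}"
    by (auto simp: set_add_def' res_add_eq)
  show ?thesis
    unfolding symmetric_complete_sum_free_sets_def symmetric_set_def complete_set_def sum_free_set_def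
      carrier neg plus mem_Collect_eq disjoint_iff by blast
qed

lemma card_scsf_eq_card_lifted:
  assumes p: "p > 2" "odd p"
  shows "card {S \<in> symmetric_complete_sum_free_sets (residue_ring p). int (card S) = n}
    = card (lifted_sets p n)"
proof (rule bij_betw_same_card[of "lift p"], rule bij_betwI[where g = "\<lambda>X. X \<inter> {0..<p}"])
  let ?F = "{S \<in> symmetric_complete_sum_free_sets (residue_ring p). int (card S) = n}"
  have p1: "p > 1" using p by simp
  note iff = symmetric_complete_sum_free_sets_iff[OF p1]
  have restrict: "lift p S \<inter> {0..<p} = S" if "S \<subseteq> {0..<p}" for S
    using that by (auto simp: lift_def)
  show "lift p S \<inter> {0..<p} = S" if "S \<in> ?F" for S using that restrict by (simp add: iff)
  show "lift p (X \<inter> {0..<p}) = X" if X: "X \<in> lifted_sets p n" for X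
  proof -
    interpret sym_complete_sum_free p "p div 2" X using X by (simp add: lifted_sets_def)
    show ?thesis using p_pos by (auto simp: lift_def mod_iff)
  qed
  show "lift p \<in> ?F \<rightarrow> lifted_sets p n"
  proof
    fix S assume S: "S \<in> ?F"
    then have S1: "S \<subseteq> {0..<p}" "S = (\<lambda>x. (- x) mod p) ` S"
      and S2: "\<And>z. z \<in> {0..<p} - S \<Longrightarrow> \<exists>x\<in>S. \<exists>y\<in>S. z = (x + y) mod p"
      and S3: "\<And>x y. x \<in> S \<Longrightarrow> y \<in> S \<Longrightarrow> (x + y) mod p \<notin> S" by (auto simp only: iff mem_Collect_eq)
    have "sym_complete_sum_free p (p div 2) (lift p S)"
    proof
      show "p = 2 * (p div 2) + 1" using p(2) by simp
      show "1 \<le> p div 2" using p by auto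
      show "x + j * p \<in> lift p S" if "x \<in> lift p S" for x j using that by (simp add: lift_def)
      show "- x \<in> lift p S" if "x \<in> lift p S" for x
      proof -
        have "(- (x mod p)) mod p \<in> S" using that S1(2) by (auto simp: lift_def)
        then show ?thesis by (simp add: lift_def mod_minus_eq)
      qed
      show "x + y \<notin> lift p S" if "x \<in> lift p S" "y \<in> lift p S" for x y
        using that S3[of "x mod p" "y mod p"] by (simp add: lift_def mod_add_eq)
      show "\<exists>x\<in>lift p S. \<exists>y\<in>lift p S. z = x + y" if "z \<notin> lift p S" for z
      proof -
        have "z mod p \<in> {0..<p} - S" using that p by (simp add: lift_def)
        then obtain a b where ab: "a \<in> S" "b \<in> S" "z mod p = (a + b) mod p" using S2 by blast
        have "(z - a) mod p = (a + b - a) mod p" using ab(3) by (metis mod_diff_left_eq)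
        then have "z - a \<in> lift p S" "a \<in> lift p S" using ab S1(1) by (auto simp: lift_def)
        then show ?thesis by (intro bexI[of _ a] bexI[of _ "z - a"]) auto
      qed
    qed
    then show "lift p S \<in> lifted_sets p n" using S restrict[OF S1(1)] by (simp add: lifted_sets_def)
  qed
  show "(\<lambda>X. X \<inter> {0..<p}) \<in> lifted_sets p n \<rightarrow> ?F"
  proof
    fix X assume X: "X \<in> lifted_sets p n"
    interpret sym_complete_sum_free p "p div 2" X using X by (simp add: lifted_sets_def)
    have neg: "(- x) mod p \<in> X \<inter> {0..<p}" if "x \<in> X" for x using that p_pos by (simp add: mod_iff sym_iff)
    have "X \<inter> {0..<p} = (\<lambda>x. (- x) mod p) ` (X \<inter> {0..<p})"
    proof (intro equalityI subsetI)
      fix x assume x: "x \<in> X \<inter> {0..<p}"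
      have "x = (- ((- x) mod p)) mod p" using x by (simp add: mod_minus_eq)
      then show "x \<in> (\<lambda>x. (- x) mod p) ` (X \<inter> {0..<p})" using neg x by blast
    qed (use neg in auto)
    moreover have "\<exists>x\<in>X \<inter> {0..<p}. \<exists>y\<in>X \<inter> {0..<p}. z = (x + y) mod p" if "z \<in> {0..<p} - X \<inter> {0..<p}" for z
    proof -
      have zr: "z \<notin> X" "0 \<le> z" "z < p" using that by auto
      then obtain x y where "x \<in> X \<inter> {0..<p}" "y \<in> X \<inter> {0..<p}" "x + y = z \<or> x + y = z + p"
        using complete_window[of z] zr by blast
      moreover from this have "z = (x + y) mod p" using that by auto
      ultimately show ?thesis by blast
    qed
    moreover have "(x + y) mod p \<notin> X \<inter> {0..<p}" if "x \<in> X \<inter> {0..<p}" "y \<in> X \<inter> {0..<p}" for x y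
      using sum_free that by (simp add: mod_iff)
    ultimately have "X \<inter> {0..<p} \<in> symmetric_complete_sum_free_sets (residue_ring p)"
      unfolding iff by blast
    then show "X \<inter> {0..<p} \<in> ?F" using X by (simp add: lifted_sets_def)
  qed
qed

text \<open>
  The two cases of the theorem are one: for \<open>p = 3 * k + 1\<close> and \<open>t = 3 * r + 1\<close> as well as for
  \<open>p = 3 * k + 2\<close> and \<open>t = 3 * r\<close> the prime is \<open>3 * n + 2 * t - 1\<close>, where \<open>n\<close> is the size of the sets.
\<close>

lemma count_by_special_sets:
  assumes prime: "prime p" and big: "p \<ge> 1000000" and p: "p = 3 * n + 2 * t - 1" "1 \<le> t" "20000 * t \<le> p"
  shows "real (card {S \<in> symmetric_complete_sum_free_sets (residue_ring p). int (card S) = n})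
    = (real_of_int p - 1) / 2 * real (g t)"
proof -
  have odd: "odd p" using prime_odd_int[OF prime] big by simp
  have "card (lifted_sets p n) = nat (p div 2) * card (middle_sets p n)"
  proof (rule card_lifted_sets[OF prime p(1,2)])
    fix X assume X: "X \<in> lifted_sets p n"
    interpret sym_complete_sum_free p "p div 2" X using X by (simp add: lifted_sets_def)
    have n: "period_card = n" using X by (simp add: lifted_sets_def period_card_def)
    have "\<exists>d\<in>{1..<p}. dilate d X \<inter> {0..<p} \<subseteq> {period_card..p - period_card}"
    proof (rule exists_middle_dilate[OF prime big])
      have "real_of_int p = 3 * real_of_int n + 2 * real_of_int t - 1" using p(1) by simp
      moreover have "20000 * real_of_int t \<le> real_of_int p" using p(3) by linarith
      moreover have "real_of_int t \<ge> 1" using p(2) by simp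
      ultimately show "real_of_int period_card \<le> real_of_int p / 3"
        "(1/3 - 1/20000) * real_of_int p \<le> real_of_int period_card"
        unfolding n by (simp_all add: algebra_simps)
    qed
    then obtain d where d: "d \<in> {1..<p}" "dilate d X \<inter> {0..<p} \<subseteq> {n..p - n}" unfolding n by blast
    have "\<not> p dvd d" using d(1) by (intro zdvd_not_zless) auto
    then obtain e where "(d * e) mod p = 1" using prime_inverse_mod[OF prime] by blast
    then have "dilate d X \<in> middle_sets p n"
      using lifted_sets_dilate[OF X] d(2) by (simp add: middle_sets_def)
    then show "\<exists>d\<in>{1..<p}. dilate d X \<in> middle_sets p n" using d(1) by blast
  qed (use p big in auto)
  then have "card {S \<in> symmetric_complete_sum_free_sets (residue_ring p). int (card S) = n}
      = nat (p div 2) * g t"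
    using card_scsf_eq_card_lifted[of p n] card_middle_sets[OF p(1,2) _ odd] odd p big by simp
  moreover have "real (nat (p div 2)) = (real_of_int p - 1) / 2"
    using odd big by (auto elim!: oddE)
  ultimately show ?thesis by (simp only: of_nat_mult)
qed

theorem theorem1p2:
  shows "\<exists>c::real. c > 0 \<and> (\<exists>p0::int. \<forall>p::int. p \<ge> p0 \<longrightarrow> prime p \<longrightarrow>
    (\<forall>r::int. 1 \<le> r \<longrightarrow> real_of_int r \<le> c * real_of_int p \<longrightarrow>
      (\<forall>k::int. p = 3 * k + 1 \<longrightarrow>
        real (card {S \<in> symmetric_complete_sum_free_sets (residue_ring p). int (card S) = k - 2 * r})
          = (real_of_int p - 1) / 2 * real (g (3 * r + 1))) \<and>
      (\<forall>k::int. p = 3 * k + 2 \<longrightarrow>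
        real (card {S \<in> symmetric_complete_sum_free_sets (residue_ring p). int (card S) = k - 2 * r + 1})
          = (real_of_int p - 1) / 2 * real (g (3 * r)))))"
proof (intro exI conjI allI impI)
  show "(1 / 100000 :: real) > 0" by simp
  fix p r k :: int
  assume p: "p \<ge> 1000000" "prime p" and r: "1 \<le> r" "real_of_int r \<le> 1 / 100000 * real_of_int p"
  have small: "100000 * r \<le> p" using r(2) by linarith
  show "real (card {S \<in> symmetric_complete_sum_free_sets (residue_ring p). int (card S) = k - 2 * r})
      = (real_of_int p - 1) / 2 * real (g (3 * r + 1))" if "p = 3 * k + 1"
    by (rule count_by_special_sets[OF p(2,1)]) (use that r small in auto)
  show "real (card {S \<in> symmetric_complete_sum_free_sets (residue_ring p). int (card S) = k - 2 * r + 1})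
      = (real_of_int p - 1) / 2 * real (g (3 * r))" if "p = 3 * k + 2"
    by (rule count_by_special_sets[OF p(2,1)]) (use that r small in auto)
qed

end
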